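(* Suppose $\mathbf X$ is a $\mathcal G$-valued random variable such that its expected signature $\mathrm{ESig}(\mathbf X)$ exists and lies in $\hat{\mathcal H}$, i.e. $$\exp(K\gamma_k)\big(\mathrm{ESig}(\mathbf X)\big)<\infty\qquad\text{for all }K>0,\ k\ge1.$$ If $\mathbf Y$ is another $\mathcal G$-valued random variable (whose expected signature exists) such that $\mathrm{ESig}(\mathbf X)=\mathrm{ESig}(\mathbf Y)$, then $\mathbf X$ and $\mathbf Y$ are equal in law.
   Context: **Trees and the Grossman–Larson algebra.** Fix $d\ge1$. A *tree* is a (non-empty, finite) rooted tree with nodes labelled by $\{1,\dots,d\}$ (up to isomorphism); a *forest* is a finite multiset of trees, including the empty forest $\mathbf 1$; $\sigma_1\sigma_2$ denotes multiset union. $\mathcal T,\mathcal F$ are the sets of trees and forests, $|\sigma|$ is the number of nodes, $\mathcal B,\mathcal H$ are the real linear spans of $\mathcal T,\mathcal F$, and $\mathcal H^*$ is the space of formal series $\sum_{\sigma\in\mathcal F}\lambda_\sigma\sigma$; $\langle h,\sigma\rangle$ denotes the coefficient of $\sigma$ in $h$. $[\sigma_1\dots\sigma_n]_i$ is the tree obtained by attaching trees $\sigma_1,\dots,\sigma_n$ to a root labelled $i$. The Connes–Kreimer coproduct $\Delta_{CK}:\mathcal H\to\mathcal H\otimes\mathcal H$ is the linear map multiplicative for juxtaposition of forests with $\Delta_{CK}\mathbf 1=\mathbf 1\otimes\mathbf 1$ and $\Delta_{CK}[\sigma_1\dots\sigma_n]_i=[\sigma_1\dots\sigma_n]_i\otimes\mathbf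 1+(\mathrm{id}\otimes B_+^i)(\Delta_{CK}\sigma_1\cdots\Delta_{CK}\sigma_n)$, where $B^i_+(\tau_1\cdots\tau_m)=[\tau_1\dots\tau_m]_i$. The Grossman–Larson product $\star$ is dual to it: $\langle\sigma_1\star\sigma_2,\sigma\rangle$ is the coefficient of $\sigma_1\otimes\sigma_2$ in $\Delta_{CK}\sigma$. The coproduct is $\delta(\sigma)=\sum_{(\sigma_1,\sigma_2):\sigma_1\sigma_2=\sigma}\sigma_1\otimes\sigma_2$. Both extend to formal series. $\mathcal G^*=\{g\in\mathcal H^*: \delta g=g\otimes g,\ g\ne0\}$. **Free generators (known theorem of Foissy and Chapoton).** There is a subspace $B\subset\mathcal B$ such that $(\mathcal H,\star,\delta)$ is isomorphic as a Hopf algebra to the tensor Hopf algebra $T(B)$ (via the algebra morphism extending $B\subset\mathcal H$). Fix such $B$ with a basis $\tau_1,\tau_2,\dots$ of trees in $\mathcal T$ with $|\tau_i|\le|\tau_j|$ for $i<j$. Every $\sigma\in\mathcal H^*$ is then uniquely a series $\sigma=\sum_{m\ge0}\sum_{r_1,\dots,r_m\ge1}\lambda_{r_1,\dots,r_m}\tau_{r_1}\star\cdots\star\tau_{r_m}$. **Topology.** For $\sigma=\sum_{m\ge0}\sum_{r_1,\dots,r_m\ge1}\lambda_{r_1,\dots,r_m}\tau_{r_1}\star\cdots\star\tau_{r_m}\in\mathcal H^*$, $k\ge1$ and $K>0$, set $\exp(K\gamma_k)(\sigma)=\sum_{m\ge0}\sum_{r_1,\dots,r_m=1}^kK^m|\lambda_{r_1,\dots,r_m}|\in[0,\infty]$.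 $\mathcal H$ carries the topology of the semi-norms $\{\exp(K\gamma_k)\}_{k\ge1,K>0}$, and its completion is $\hat{\mathcal H}=\{\sigma\in\mathcal H^*:\exp(K\gamma_k)(\sigma)<\infty\ \forall k\ge1,K>0\}$ with the same semi-norms. $\mathcal G=\mathcal G^*\cap\hat{\mathcal H}$ with the subspace topology (a Polish group under $\star$) and its Borel $\sigma$-algebra. **Expected signature.** For a $\mathcal G$-valued random variable $\mathbf X$ such that $\langle\mathbf X,\sigma\rangle$ is integrable for every $\sigma\in\mathcal F$ (in which case one says the expected signature exists), $\mathrm{ESig}(\mathbf X)=\sum_{\sigma\in\mathcal F}\mathbb E[\langle\mathbf X,\sigma\rangle]\,\sigma\in\mathcal H^*$. *)

theory Defs
  imports
    "HOL-Probability.Probability_Measure"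
    "HOL-Library.Multiset"
    "HOL-Library.Poly_Mapping"
    "HOL-Library.Product_Plus"
begin

section \<open>Labelled rooted trees and forests\<close>

text \<open>The children of a node form a multiset, so equality of trees is isomorphism of non-planar
  labelled rooted trees. The label set is the universe of a finite (nonempty) type \<open>'d\<close> with
  \<open>d\<close> elements. Juxtaposition of forests is addition of multisets and the empty forest is \<open>0\<close>.\<close>

datatype 'd rtree = Root 'd "'d rtree multiset"

type_synonym 'd forest = "'d rtree multiset"

primrec nodes :: "'d rtree \<Rightarrow> nat" where
  "nodes (Root i ts) = 1 + sum_mset (image_mset nodes ts)"


section \<open>Formal series and the Connes--Kreimer coproduct\<close>

text \<open>A formal series is given by its coefficients, so that \<open>h \<sigma>\<close> is the pairing of \<open>h\<close>
  with \<open>\<sigma>\<close>.\<close>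

type_synonym 'd series = "'d forest \<Rightarrow> real"

definition H :: "'d series set" where
  "H = {h. finite {\<sigma>. h \<sigma> \<noteq> 0}}"

definition basis :: "'d forest \<Rightarrow> 'd series" where
  "basis \<sigma> = (\<lambda>\<rho>. if \<rho> = \<sigma> then 1 else 0)"

text \<open>Elements of the tensor square of \<open>H\<close> are finitely supported functions on pairs of forests;
  the convolution product of \<^typ>\<open>('d forest \<times> 'd forest) \<Rightarrow>\<^sub>0 real\<close> is then the tensor
  square of the juxtaposition product. The next map is \<open>id \<otimes> B\<^sub>+\<^sup>i\<close>.\<close>

definition id_tensor_Bplus ::
    "'d \<Rightarrow> (('d forest \<times> 'd forest) \<Rightarrow>\<^sub>0 real) \<Rightarrow> (('d forest \<times> 'd forest) \<Rightarrow>\<^sub>0 real)" where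
  "id_tensor_Bplus i p =
     (\<Sum>(\<sigma>\<^sub>1, \<sigma>\<^sub>2)\<in>Poly_Mapping.keys p.
        Poly_Mapping.single (\<sigma>\<^sub>1, {#Root i \<sigma>\<^sub>2#}) (Poly_Mapping.lookup p (\<sigma>\<^sub>1, \<sigma>\<^sub>2)))"

primrec CK_tree :: "'d rtree \<Rightarrow> (('d forest \<times> 'd forest) \<Rightarrow>\<^sub>0 real)" where
  "CK_tree (Root i ts) =
     Poly_Mapping.single ({#Root i ts#}, 0) 1 + id_tensor_Bplus i (prod_mset (image_mset CK_tree ts))"

definition CK :: "'d forest \<Rightarrow> (('d forest \<times> 'd forest) \<Rightarrow>\<^sub>0 real)" where
  "CK \<sigma> = prod_mset (image_mset CK_tree \<sigma>)"


section \<open>The Grossman--Larson product and the coproduct on series\<close>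

definition GL :: "'d series \<Rightarrow> 'd series \<Rightarrow> 'd series"  (infixl \<open>\<star>\<close> 70) where
  "(f \<star> g) = (\<lambda>\<sigma>. \<Sum>(\<sigma>\<^sub>1, \<sigma>\<^sub>2)\<in>Poly_Mapping.keys (CK \<sigma>).
                 Poly_Mapping.lookup (CK \<sigma>) (\<sigma>\<^sub>1, \<sigma>\<^sub>2) * f \<sigma>\<^sub>1 * g \<sigma>\<^sub>2)"

definition delta_forest :: "'d forest \<Rightarrow> 'd forest \<times> 'd forest \<Rightarrow> real" where
  "delta_forest \<sigma> = (\<lambda>(\<sigma>\<^sub>1, \<sigma>\<^sub>2). if \<sigma>\<^sub>1 + \<sigma>\<^sub>2 = \<sigma> then 1 else 0)"

text \<open>Each pair of forests occurs in \<open>delta_forest \<sigma>\<close> for exactly one \<open>\<sigma>\<close>, so the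
  sum in the extension to series has a single term.\<close>

definition delta :: "'d series \<Rightarrow> 'd forest \<times> 'd forest \<Rightarrow> real" where
  "delta h = (\<lambda>p. \<Sum>\<sigma> | delta_forest \<sigma> p \<noteq> 0. h \<sigma> * delta_forest \<sigma> p)"

lemma delta_apply: "delta h (\<sigma>\<^sub>1, \<sigma>\<^sub>2) = h (\<sigma>\<^sub>1 + \<sigma>\<^sub>2)"
proof -
  have "{\<sigma>. delta_forest \<sigma> (\<sigma>\<^sub>1, \<sigma>\<^sub>2) \<noteq> 0} = {\<sigma>\<^sub>1 + \<sigma>\<^sub>2}"
    by (auto simp: delta_forest_def)
  then show ?thesis
    by (simp add: delta_def delta_forest_def)
qed

definition Gstar :: "'d series set" where
  "Gstar = {g. delta g = (\<lambda>(\<sigma>\<^sub>1, \<sigma>\<^sub>2). g \<sigma>\<^sub>1 * g \<sigma>\<^sub>2) \<and> g \<noteq> (\<lambda>_. 0)}"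


section \<open>Free generators\<close>

text \<open>A sequence \<open>\<tau>\<close> of distinct trees is a basis of its span \<open>B\<close>. In this basis the tensor
  algebra \<open>T(B)\<close> is the space \<^typ>\<open>nat list \<Rightarrow>\<^sub>0 real\<close> of noncommutative polynomials, the word
  \<open>[r\<^sub>1, \<dots>, r\<^sub>m]\<close> standing for \<open>\<tau> r\<^sub>1 \<otimes> \<dots> \<otimes> \<tau> r\<^sub>m\<close>. Generators are numbered from \<open>0\<close>
  rather than from \<open>1\<close>.\<close>

definition T_mult :: "(nat list \<Rightarrow>\<^sub>0 real) \<Rightarrow> (nat list \<Rightarrow>\<^sub>0 real) \<Rightarrow> (nat list \<Rightarrow>\<^sub>0 real)" where
  "T_mult p q =
     (\<Sum>u\<in>Poly_Mapping.keys p. \<Sum>v\<in>Poly_Mapping.keys q.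
        Poly_Mapping.single (u @ v) (Poly_Mapping.lookup p u * Poly_Mapping.lookup q v))"

text \<open>The coproduct of \<open>T(B)\<close> is the algebra morphism for which letters are primitive, that is,
  a word is sent to the sum of all ways of splitting it into two complementary subwords.\<close>

definition T_coprod :: "(nat list \<Rightarrow>\<^sub>0 real) \<Rightarrow> ((nat list \<times> nat list) \<Rightarrow>\<^sub>0 real)" where
  "T_coprod p =
     (\<Sum>w\<in>Poly_Mapping.keys p. \<Sum>I\<in>Pow {..<length w}.
        Poly_Mapping.single (nths w I, nths w (- I)) (Poly_Mapping.lookup p w))"

primrec GL_word :: "(nat \<Rightarrow> 'd rtree) \<Rightarrow> nat list \<Rightarrow> 'd series" where
  "GL_word \<tau> [] = basis 0"
| "GL_word \<tau> (r # w) = basis {#\<tau> r#} \<star> GL_word \<tau> w"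

definition T_to_H :: "(nat \<Rightarrow> 'd rtree) \<Rightarrow> (nat list \<Rightarrow>\<^sub>0 real) \<Rightarrow> 'd series" where
  "T_to_H \<tau> p = (\<lambda>\<sigma>. \<Sum>w\<in>Poly_Mapping.keys p. Poly_Mapping.lookup p w * GL_word \<tau> w \<sigma>)"

text \<open>The tensor square of \<open>T_to_H \<tau>\<close>.\<close>

definition T_to_H2 ::
    "(nat \<Rightarrow> 'd rtree) \<Rightarrow> ((nat list \<times> nat list) \<Rightarrow>\<^sub>0 real) \<Rightarrow> 'd forest \<times> 'd forest \<Rightarrow> real" where
  "T_to_H2 \<tau> q = (\<lambda>(\<sigma>\<^sub>1, \<sigma>\<^sub>2). \<Sum>(u, v)\<in>Poly_Mapping.keys q.
       Poly_Mapping.lookup q (u, v) * GL_word \<tau> u \<sigma>\<^sub>1 * GL_word \<tau> v \<sigma>\<^sub>2)"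

text \<open>Linearity of \<open>T_to_H \<tau>\<close> holds by construction, and an isomorphism of bialgebras
  automatically respects the antipodes.\<close>

definition T_to_H_Hopf_iso :: "(nat \<Rightarrow> 'd rtree) \<Rightarrow> bool" where
  "T_to_H_Hopf_iso \<tau> \<longleftrightarrow>
     bij_betw (T_to_H \<tau>) UNIV H \<and>
     T_to_H \<tau> (Poly_Mapping.single [] 1) = basis 0 \<and>
     (\<forall>p q. T_to_H \<tau> (T_mult p q) = T_to_H \<tau> p \<star> T_to_H \<tau> q) \<and>
     (\<forall>p. T_to_H \<tau> p 0 = Poly_Mapping.lookup p []) \<and>
     (\<forall>p. delta (T_to_H \<tau> p) = T_to_H2 \<tau> (T_coprod p))"

definition free_generators :: "(nat \<Rightarrow> 'd rtree) \<Rightarrow> bool" where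
  "free_generators \<tau> \<longleftrightarrow>
     inj \<tau> \<and> mono (\<lambda>r. nodes (\<tau> r)) \<and> T_to_H_Hopf_iso \<tau>"


section \<open>The semi-norms, the completion and the group\<close>

text \<open>The coefficients of a series with respect to the products
  \<open>\<tau> r\<^sub>1 \<star> \<dots> \<star> \<tau> r\<^sub>m\<close>. By homogeneity, for free generators only finitely many words
  contribute to the coefficient of a given forest.\<close>

definition expansion :: "(nat \<Rightarrow> 'd rtree) \<Rightarrow> 'd series \<Rightarrow> nat list \<Rightarrow> real" where
  "expansion \<tau> h = (THE c. \<forall>\<sigma>. ((\<lambda>w. c w * GL_word \<tau> w \<sigma>) has_sum h \<sigma>) UNIV)"

text \<open>The letters \<open>0, \<dots>, k - 1\<close> are the first \<open>k\<close> generators.\<close>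

definition exp_gamma :: "(nat \<Rightarrow> 'd rtree) \<Rightarrow> real \<Rightarrow> nat \<Rightarrow> 'd series \<Rightarrow> ennreal" where
  "exp_gamma \<tau> K k h =
     suminf (\<lambda>m. \<Sum>w | length w = m \<and> set w \<subseteq> {..<k}. ennreal (K ^ m * \<bar>expansion \<tau> h w\<bar>))"

definition Hhat :: "(nat \<Rightarrow> 'd rtree) \<Rightarrow> 'd series set" where
  "Hhat \<tau> = {h. \<forall>k\<ge>1. \<forall>K>0. exp_gamma \<tau> K k h < \<infinity>}"

definition Hhat_topology :: "(nat \<Rightarrow> 'd rtree) \<Rightarrow> 'd series topology" where
  "Hhat_topology \<tau> = topology_generated_by
     {{y \<in> Hhat \<tau>. exp_gamma \<tau> K k (\<lambda>\<sigma>. y \<sigma> - x \<sigma>) < ennreal \<epsilon>} | x K k \<epsilon>.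
        x \<in> Hhat \<tau> \<and> K > 0 \<and> k \<ge> 1 \<and> \<epsilon> > 0}"

definition G :: "(nat \<Rightarrow> 'd rtree) \<Rightarrow> 'd series set" where
  "G \<tau> = Gstar \<inter> Hhat \<tau>"

definition G_topology :: "(nat \<Rightarrow> 'd rtree) \<Rightarrow> 'd series topology" where
  "G_topology \<tau> = subtopology (Hhat_topology \<tau>) (G \<tau>)"

definition G_borel :: "(nat \<Rightarrow> 'd rtree) \<Rightarrow> 'd series measure" where
  "G_borel \<tau> = sigma (G \<tau>) {U. openin (G_topology \<tau>) U}"


section \<open>Expected signature\<close>

definition ESig_exists :: "'a measure \<Rightarrow> ('a \<Rightarrow> 'd series) \<Rightarrow> bool" where
  "ESig_exists M X \<longleftrightarrow> (\<forall>\<sigma>. integrable M (\<lambda>\<omega>. X \<omega> \<sigma>))"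

definition ESig :: "'a measure \<Rightarrow> ('a \<Rightarrow> 'd series) \<Rightarrow> 'd series" where
  "ESig M X = (\<lambda>\<sigma>. \<integral>\<omega>. X \<omega> \<sigma> \<partial>M)"

end

theory Submission
  imports Defs "HOL-Analysis.Weierstrass_Theorems"
begin

text \<open>
  In the coordinates \<open>c w\<close> with respect to the words in the free generators, group-likeness of a series
  means that a product of two coordinates is the sum of the coordinates of all shuffles of the two
  words (\<open>shuffle_character_expansion\<close>). The expected signature therefore fixes all joint moments of the
  coordinates. This does not settle the matter: the \<open>2n\<close>-th power of a coordinate of a word of length
  \<open>m\<close> expands into \<open>(2nm)! / (m!)^(2n)\<close> shuffles, and for \<open>m \<ge> 2\<close> the resulting moment bounds are
  too weak for the classical criteria of determinacy.

  Moments are replaced by the functions \<open>\<Sum>w. a w * c w\<close> over words in finitely many letters with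
  exponentially bounded coefficients \<open>a\<close>. They converge on the completion, they are closed under
  multiplication (\<open>pairing_mult\<close>), and their expectation is obtained by inserting the expected signature
  (\<open>expected_pairing\<close>). The exchange of expectation and series is justified by the shuffle relation
  itself: the second moment of a coordinate is a sum of expected coordinates of twice the length, so
  that the assumed decay of the expected signature passes to the absolute first moments
  (\<open>entire_expected_abs\<close>).

  Enough of these functions are bounded on the group. Sending the generators to skew-symmetric matrices
  defines a representation of the tensor algebra that maps group elements to orthogonal matrices, and the
  entries of an orthogonal matrix are at most \<open>1\<close> in absolute value. For every word \<open>w\<close> of length \<open>m\<close> there
  is such a representation, by tridiagonal matrices of size \<open>m + 1\<close>, with a corner entry that becomes
  \<open>c w * t ^ m\<close> up to higher order when the generators are scaled by \<open>t\<close> (\<open>abs_pairing_walk_le\<close>,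
  \<open>walk_pairing_recovers\<close>). The bounded functions thus generate the \<open>\<sigma>\<close>-algebra of the coordinates. That
  is the Borel \<open>\<sigma>\<close>-algebra, because the topology of the completion has a countable base of balls
  (\<open>countable_ball_in_open\<close>, \<open>sets_G_borel_test_functions\<close>).

  Two laws with the same expected signature consequently agree on a multiplicative system of bounded
  functions that generates the Borel sets, and hence coincide (\<open>multiplicative_system_eqI\<close>).
\<close>

section \<open>Words and unshuffles\<close>

text \<open>The sum runs over all splittings of a word into two complementary subwords, counted with
  multiplicity: it pairs \<open>F\<close> with the coproduct of the word in the tensor algebra.\<close>

definition unshuffle_sum :: "(nat list \<Rightarrow> nat list \<Rightarrow> real) \<Rightarrow> nat list \<Rightarrow> real" where
  "unshuffle_sum F w = (\<Sum>I\<in>Pow {..<length w}. F (nths w I) (nths w (- I)))"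

definition words :: "nat \<Rightarrow> nat \<Rightarrow> nat list set" where
  "words k m = {w. length w = m \<and> set w \<subseteq> {..<k}}"

lemma finite_words [simp]: "finite (words k m)"
  unfolding words_def using finite_lists_length_eq[of "{..<k}" m] by (simp add: conj_commute)

lemma card_words: "card (words k m) = k ^ m"
  unfolding words_def using card_lists_length_eq[of "{..<k}" m] by (simp add: conj_commute)

lemma words_0 [simp]: "words k 0 = {[]}"
  by (auto simp: words_def)

lemma unshuffle_sum_Nil [simp]: "unshuffle_sum F [] = F [] []"
  by (simp add: unshuffle_sum_def)

text \<open>The first letter goes either to the left or to the right subword.\<close>

lemma unshuffle_sum_Cons:
  "unshuffle_sum F (x # w) =
     unshuffle_sum (\<lambda>u v. F (x # u) v) w + unshuffle_sum (\<lambda>u v. F u (x # v)) w"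
proof -
  have Pow: "Pow {..<Suc n} = (`) Suc ` Pow {..<n} \<union> insert 0 ` (`) Suc ` Pow {..<n}" for n
    unfolding lessThan_Suc_eq_insert_0 Pow_insert image_Pow_surj[OF refl, symmetric] by blast
  have inj1: "inj_on ((`) Suc) A" for A
    by (auto simp: inj_on_def inj_image_eq_iff)
  have inj2: "inj_on (insert 0) ((`) Suc ` A)" for A
    by (rule inj_onI) (auto simp: inj_image_eq_iff set_eq_iff)
  have sh: "{j. Suc j \<in> insert 0 (Suc ` J)} = J" "{j. Suc j \<in> Suc ` J} = J"
    "{j. Suc j \<notin> insert 0 (Suc ` J)} = - J" "{j. Suc j \<notin> Suc ` J} = - J" for J by auto
  show ?thesis
    unfolding unshuffle_sum_def length_Cons Pow
    by (subst sum.union_disjoint)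
      (auto simp: sum.reindex inj1 inj2 nths_Cons sh)
qed

text \<open>Everything that is additive over letters (length, letters used, number of nodes) is conserved by
  a splitting, and all of these follow from the one equation of multisets.\<close>

lemma mset_nths_Compl: "mset (nths w I) + mset (nths w (- I)) = mset w"
proof (induction w arbitrary: I)
  case (Cons x w)
  have "- {j. Suc j \<in> I} = {j. Suc j \<notin> I}" by auto
  with Cons[of "{j. Suc j \<in> I}"] show ?case by (auto simp: nths_Cons)
qed simp

lemma unshuffle_sum_cong:
  assumes "\<And>u v. mset u + mset v = mset w \<Longrightarrow> F u v = F' u v"
  shows "unshuffle_sum F w = unshuffle_sum F' w"
  unfolding unshuffle_sum_def by (intro sum.cong refl assms mset_nths_Compl)

lemma unshuffle_sum_eq_0:
  assumes "\<And>u v. mset u + mset v = mset w \<Longrightarrow> F u v = 0"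
  shows "unshuffle_sum F w = 0"
  using unshuffle_sum_cong[of w F "\<lambda>_ _. 0", OF assms] by (simp add: unshuffle_sum_def)

lemma unshuffle_sum_add:
  "unshuffle_sum (\<lambda>u v. F u v + F' u v) w = unshuffle_sum F w + unshuffle_sum F' w"
  by (simp add: unshuffle_sum_def sum.distrib)

lemma unshuffle_sum_sum:
  "unshuffle_sum (\<lambda>u v. \<Sum>i\<in>A. F i u v) w = (\<Sum>i\<in>A. unshuffle_sum (F i) w)"
  unfolding unshuffle_sum_def by (rule sum.swap)

lemma unshuffle_sum_cmult:
  "unshuffle_sum (\<lambda>u v. r * F u v) w = r * unshuffle_sum F w"
  by (simp add: unshuffle_sum_def sum_distrib_left)

lemma unshuffle_sum_mono:
  assumes "\<And>u v. mset u + mset v = mset w \<Longrightarrow> F u v \<le> F' u v"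
  shows "unshuffle_sum F w \<le> unshuffle_sum F' w"
  unfolding unshuffle_sum_def by (intro sum_mono assms mset_nths_Compl)

lemma unshuffle_sum_abs: "\<bar>unshuffle_sum F w\<bar> \<le> unshuffle_sum (\<lambda>u v. \<bar>F u v\<bar>) w"
  unfolding unshuffle_sum_def by (rule sum_abs)

text \<open>Binomial expansion: each letter contributes a factor \<open>x\<close> or a factor \<open>y\<close>. This is the reason
  why exponentially bounded coefficients stay so under multiplication.\<close>

lemma unshuffle_sum_power:
  "unshuffle_sum (\<lambda>u v. x ^ length u * y ^ length v) w = (x + y) ^ length w"
proof (induction w)
  case (Cons a w)
  have "unshuffle_sum (\<lambda>u v. x ^ length (a # u) * y ^ length v) w
      = unshuffle_sum (\<lambda>u v. x * (x ^ length u * y ^ length v)) w"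
    "unshuffle_sum (\<lambda>u v. x ^ length u * y ^ length (a # v)) w
      = unshuffle_sum (\<lambda>u v. y * (x ^ length u * y ^ length v)) w"
    by (simp_all add: mult_ac)
  then show ?case
    by (simp only: unshuffle_sum_Cons unshuffle_sum_cmult Cons.IH) (simp add: algebra_simps)
qed simp

definition word_pair :: "nat list \<Rightarrow> nat list \<Rightarrow> nat list \<Rightarrow> nat list \<Rightarrow> real" where
  "word_pair u v u' v' = of_bool (u' = u \<and> v' = v)"

text \<open>The coordinates of a group-like series: the product of two coordinates is the sum of the
  coordinates of all shuffles. The sum is taken over words in any alphabet \<open>{..<k}\<close> that contains the
  letters of both words; the other words of that length contribute \<open>0\<close>.\<close>

definition shuffle_character :: "(nat list \<Rightarrow> real) \<Rightarrow> bool" where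
  "shuffle_character c \<longleftrightarrow> c [] = 1 \<and>
     (\<forall>k u v. set u \<subseteq> {..<k} \<longrightarrow> set v \<subseteq> {..<k} \<longrightarrow>
        c u * c v = (\<Sum>w\<in>words k (length u + length v). c w * unshuffle_sum (word_pair u v) w))"

definition word_pairs :: "nat \<Rightarrow> nat \<Rightarrow> (nat list \<times> nat list) set" where
  "word_pairs k l = {(u, v). length u + length v = l \<and> set u \<union> set v \<subseteq> {..<k}}"

text \<open>The left-hand side is the form in which a Cauchy product of two series indexed by word length
  delivers its terms.\<close>

lemma sum_word_pairs:
  fixes g :: "nat list \<Rightarrow> nat list \<Rightarrow> real"
  shows "(\<Sum>i\<le>l. \<Sum>u\<in>words k i. \<Sum>v\<in>words k (l - i). g u v) = (\<Sum>(u, v)\<in>word_pairs k l. g u v)"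
    and finite_word_pairs: "finite (word_pairs k l)"
proof -
  have eq: "word_pairs k l = (\<lambda>(i, u, v). (u, v)) ` (SIGMA i:{..l}. words k i \<times> words k (l - i))"
    by (force simp: word_pairs_def words_def image_iff)
  show "finite (word_pairs k l)" unfolding eq by (intro finite_imageI finite_SigmaI) auto
  have "inj_on (\<lambda>(i, u, v). (u, v)) (SIGMA i:{..l}. words k i \<times> words k (l - i))"
    by (auto simp: inj_on_def words_def)
  then show "(\<Sum>i\<le>l. \<Sum>u\<in>words k i. \<Sum>v\<in>words k (l - i). g u v) = (\<Sum>(u, v)\<in>word_pairs k l. g u v)"
    unfolding eq by (simp add: sum.reindex sum.Sigma sum.cartesian_product split_def)
qed

text \<open>The defining relation of a shuffle character extended bilinearly from \<^const>\<open>word_pair\<close> to an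
  arbitrary kernel \<open>F\<close>.\<close>

lemma shuffle_character_bilinear:
  assumes c: "shuffle_character c"
  shows "(\<Sum>(u, v)\<in>word_pairs k l. F u v * (c u * c v)) = (\<Sum>w\<in>words k l. c w * unshuffle_sum F w)"
proof -
  have decomp: "unshuffle_sum F w = (\<Sum>(u, v)\<in>word_pairs k l. F u v * unshuffle_sum (word_pair u v) w)"
    if w: "w \<in> words k l" for w
  proof -
    have "unshuffle_sum F w = unshuffle_sum (\<lambda>u' v'. \<Sum>p\<in>word_pairs k l. F (fst p) (snd p) * word_pair (fst p) (snd p) u' v') w"
    proof (rule unshuffle_sum_cong)
      fix u' v' assume uv: "mset u' + mset v' = mset w"
      have "set u' \<union> set v' = set w" "length u' + length v' = length w"
        by (metis uv set_mset_mset set_mset_union) (metis uv size_mset size_union)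
      then have "(u', v') \<in> word_pairs k l" using w by (auto simp: words_def word_pairs_def)
      moreover have "F (fst p) (snd p) * word_pair (fst p) (snd p) u' v' =
          (if p = (u', v') then F u' v' else 0)" for p
        by (cases p) (auto simp: word_pair_def)
      ultimately show "F u' v' = (\<Sum>p\<in>word_pairs k l. F (fst p) (snd p) * word_pair (fst p) (snd p) u' v')"
        by (simp add: finite_word_pairs)
    qed
    then show ?thesis by (simp add: unshuffle_sum_sum unshuffle_sum_cmult split_def)
  qed
  have "(\<Sum>(u, v)\<in>word_pairs k l. F u v * (c u * c v)) =
      (\<Sum>(u, v)\<in>word_pairs k l. \<Sum>w\<in>words k l. F u v * (c w * unshuffle_sum (word_pair u v) w))"
  proof (intro sum.cong refl, clarify)
    fix u v assume "(u, v) \<in> word_pairs k l"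
    then have "set u \<subseteq> {..<k}" "set v \<subseteq> {..<k}" "length u + length v = l"
      by (auto simp: word_pairs_def)
    with c show "F u v * (c u * c v) = (\<Sum>w\<in>words k l. F u v * (c w * unshuffle_sum (word_pair u v) w))"
      by (auto simp: shuffle_character_def sum_distrib_left)
  qed
  also have "\<dots> = (\<Sum>w\<in>words k l. c w * (\<Sum>(u, v)\<in>word_pairs k l. F u v * unshuffle_sum (word_pair u v) w))"
    unfolding sum_distrib_left split_def by (subst sum.swap) (simp add: mult_ac)
  also have "\<dots> = (\<Sum>w\<in>words k l. c w * unshuffle_sum F w)"
    by (intro sum.cong refl) (simp add: decomp)
  finally show ?thesis .
qed

section \<open>Exponentially bounded functionals on shuffle characters\<close>

text \<open>Such coefficients pair absolutely with every element of the completion; they play the role of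
  its continuous dual, once the alphabet is cut down to finitely many letters.\<close>

definition exp_bounded :: "(nat list \<Rightarrow> real) \<Rightarrow> bool" where
  "exp_bounded a \<longleftrightarrow> (\<exists>C\<ge>0. \<exists>L>0. \<forall>w. \<bar>a w\<bar> \<le> C * L ^ length w)"

text \<open>Finiteness of all the semi-norms, read off from the coordinates.\<close>

definition entire :: "(nat list \<Rightarrow> real) \<Rightarrow> bool" where
  "entire c \<longleftrightarrow> (\<forall>k L. L > 0 \<longrightarrow> summable (\<lambda>m. \<Sum>w\<in>words k m. L ^ m * \<bar>c w\<bar>))"

definition pair_deg :: "nat \<Rightarrow> (nat list \<Rightarrow> real) \<Rightarrow> (nat list \<Rightarrow> real) \<Rightarrow> nat \<Rightarrow> real" where
  "pair_deg k a c m = (\<Sum>w\<in>words k m. a w * c w)"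

definition pairing :: "nat \<Rightarrow> (nat list \<Rightarrow> real) \<Rightarrow> (nat list \<Rightarrow> real) \<Rightarrow> real" where
  "pairing k a c = suminf (\<lambda>m. pair_deg k a c m)"

lemma abs_pair_deg_le:
  assumes "\<And>w. \<bar>a w\<bar> \<le> C * L ^ length w"
  shows "\<bar>pair_deg k a c m\<bar> \<le> C * (\<Sum>w\<in>words k m. L ^ m * \<bar>c w\<bar>)"
proof -
  have "\<bar>pair_deg k a c m\<bar> \<le> (\<Sum>w\<in>words k m. \<bar>a w\<bar> * \<bar>c w\<bar>)"
    unfolding pair_deg_def by (rule order_trans[OF sum_abs]) (simp add: abs_mult)
  also have "\<dots> \<le> (\<Sum>w\<in>words k m. (C * L ^ m) * \<bar>c w\<bar>)"
    using assms by (intro sum_mono mult_right_mono) (auto simp: words_def)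
  finally show ?thesis by (simp add: sum_distrib_left mult.assoc)
qed

lemma summable_pair_deg:
  assumes "exp_bounded a" "entire c"
  shows "summable (\<lambda>m. norm (pair_deg k a c m))"
proof -
  from assms(1) obtain C L where CL: "L > 0" "\<And>w. \<bar>a w\<bar> \<le> C * L ^ length w"
    by (auto simp: exp_bounded_def)
  have "summable (\<lambda>m. C * (\<Sum>w\<in>words k m. L ^ m * \<bar>c w\<bar>))"
    using assms(2) CL(1) by (intro summable_mult) (auto simp: entire_def)
  then show ?thesis
    by (rule summable_comparison_test'[where N=0]) (use abs_pair_deg_le[OF CL(2)] in simp)
qed

text \<open>The product of coefficient families that corresponds to pointwise multiplication of the
  functionals on shuffle characters.\<close>

definition unshuffle_prod :: "(nat list \<Rightarrow> real) \<Rightarrow> (nat list \<Rightarrow> real) \<Rightarrow> nat list \<Rightarrow> real" where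
  "unshuffle_prod a b = unshuffle_sum (\<lambda>u v. a u * b v)"

lemma exp_bounded_unshuffle_prod:
  assumes "exp_bounded a" "exp_bounded b"
  shows "exp_bounded (unshuffle_prod a b)"
proof -
  from assms obtain C L D M where
    C: "C \<ge> 0" "L > 0" "\<And>w. \<bar>a w\<bar> \<le> C * L ^ length w" and
    D: "D \<ge> 0" "M > 0" "\<And>w. \<bar>b w\<bar> \<le> D * M ^ length w"
    by (auto simp: exp_bounded_def)
  have "\<bar>unshuffle_prod a b w\<bar> \<le> (C * D) * (L + M) ^ length w" for w
  proof -
    have "\<bar>unshuffle_prod a b w\<bar> \<le> unshuffle_sum (\<lambda>u v. \<bar>a u * b v\<bar>) w"
      unfolding unshuffle_prod_def by (rule unshuffle_sum_abs)
    also have "\<dots> \<le> unshuffle_sum (\<lambda>u v. (C * D) * (L ^ length u * M ^ length v)) w"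
    proof (rule unshuffle_sum_mono)
      fix u v
      have "\<bar>a u\<bar> * \<bar>b v\<bar> \<le> (C * L ^ length u) * (D * M ^ length v)"
        by (intro mult_mono C D) (use C D in auto)
      then show "\<bar>a u * b v\<bar> \<le> (C * D) * (L ^ length u * M ^ length v)"
        by (simp add: abs_mult mult_ac)
    qed
    finally show ?thesis by (simp add: unshuffle_sum_cmult unshuffle_sum_power)
  qed
  with C D show ?thesis unfolding exp_bounded_def
    by (intro exI[of _ "C * D"] conjI exI[of _ "L + M"]) auto
qed

text \<open>Cauchy product of the two series, degree by degree reduced to the shuffle relation.\<close>

lemma pairing_mult:
  assumes c: "shuffle_character c" "entire c" and a: "exp_bounded a" and b: "exp_bounded b"
  shows "pairing k a c * pairing k b c = pairing k (unshuffle_prod a b) c"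
proof -
  have "(\<Sum>i\<le>l. pair_deg k a c i * pair_deg k b c (l - i)) = pair_deg k (unshuffle_prod a b) c l" for l
  proof -
    have "(\<Sum>i\<le>l. pair_deg k a c i * pair_deg k b c (l - i))
        = (\<Sum>i\<le>l. \<Sum>u\<in>words k i. \<Sum>v\<in>words k (l - i). (a u * b v) * (c u * c v))"
      by (simp add: pair_deg_def sum_product mult_ac)
    also have "\<dots> = (\<Sum>w\<in>words k l. c w * unshuffle_prod a b w)"
      unfolding sum_word_pairs unshuffle_prod_def by (rule shuffle_character_bilinear[OF c(1)])
    finally show ?thesis by (simp add: pair_deg_def mult.commute)
  qed
  then show ?thesis
    unfolding pairing_def
    by (subst Cauchy_product) (use summable_pair_deg a b c in auto)
qed

section \<open>Bounded functionals from orthogonal representations\<close>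

text \<open>For a word \<open>w\<close> of length \<open>m\<close>, the letter \<open>r\<close> acts on functions on the sites \<open>0, \<dots>, m\<close> by the
  skew-symmetric tridiagonal matrix with entry \<open>1\<close> at \<open>(i, i + 1)\<close> and \<open>-1\<close> at \<open>(i + 1, i)\<close> for each \<open>i\<close>
  with \<open>w ! i = r\<close>.\<close>

definition hop :: "nat list \<Rightarrow> nat \<Rightarrow> (nat \<Rightarrow> real) \<Rightarrow> nat \<Rightarrow> real" where
  "hop w r x i = (if i < length w \<and> w ! i = r then x (Suc i) else 0)
     - (if 0 < i \<and> i \<le> length w \<and> w ! (i - 1) = r then x (i - 1) else 0)"

lemma hop_skew:
  "(\<Sum>i\<le>length w. hop w r x i * y i + x i * hop w r y i) = 0"
proof -
  define n where "n = length w"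
  \<comment> \<open>The contribution of the edge between the sites \<open>i\<close> and \<open>i + 1\<close>; it is met once from either end,
    with opposite signs.\<close>
  define g where "g i = (if w ! i = r then x (Suc i) * y i + x i * y (Suc i) else 0)" for i
  have "(\<Sum>i\<le>n. hop w r x i * y i + x i * hop w r y i) =
     (\<Sum>i\<le>n. if i < n then g i else 0) - (\<Sum>i\<le>n. if 0 < i then g (i - 1) else 0)"
    unfolding sum_subtractf[symmetric]
    by (intro sum.cong refl) (auto simp: hop_def g_def n_def algebra_simps)
  also have "(\<Sum>i\<le>n. if i < n then g i else 0) = (\<Sum>i<n. g i)"
    by (simp add: lessThan_Suc_atMost[symmetric])
  also have "(\<Sum>i\<le>n. if 0 < i then g (i - 1) else 0) = (\<Sum>i<n. g i)"
    unfolding lessThan_Suc_atMost[symmetric] by (subst sum.lessThan_Suc_shift) simp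
  finally show ?thesis by (simp add: n_def)
qed

text \<open>The last column of the matrix that represents the word \<open>u\<close>. Expanded into paths, its entry at
  site \<open>i\<close> is a signed count of the paths from \<open>i\<close> to the last site that follow the letters of \<open>u\<close>.\<close>

primrec walk :: "nat list \<Rightarrow> nat list \<Rightarrow> nat \<Rightarrow> real" where
  "walk w [] = (\<lambda>i. of_bool (i = length w))"
| "walk w (r # u) = hop w r (walk w u)"

text \<open>Each site has at most two neighbours.\<close>

lemma abs_walk_le: "\<bar>walk w u i\<bar> \<le> 2 ^ length u"
proof (induction u arbitrary: i)
  case (Cons r u)
  have "\<bar>hop w r x i\<bar> \<le> \<bar>x (Suc i)\<bar> + \<bar>x (i - 1)\<bar>" for x
    by (auto simp: hop_def)
  from this[of "walk w u"] Cons[of "Suc i"] Cons[of "i - 1"] show ?case by simp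
qed simp

lemma exp_bounded_walk: "exp_bounded (\<lambda>u. walk w u i)"
  unfolding exp_bounded_def using abs_walk_le by (intro exI[of _ 1] conjI exI[of _ 2]) auto

text \<open>The last site is out of reach.\<close>

lemma walk_short: "length u + i < length w \<Longrightarrow> walk w u i = 0"
  by (induction u arbitrary: i) (auto simp: hop_def)

text \<open>With no step to spare the path must go straight up, so it reads off the letters of \<open>w\<close>.\<close>

lemma walk_exact: "length u + i = length w \<Longrightarrow> walk w u i = of_bool (u = drop i w)"
proof (induction u arbitrary: i)
  case (Cons r u)
  have i: "i < length w" using Cons.prems by simp
  then have d: "drop i w = w ! i # drop (Suc i) w" by (rule Cons_nth_drop_Suc[symmetric])
  have "0 < i \<Longrightarrow> walk w u (i - 1) = 0" using Cons.prems by (intro walk_short) auto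
  moreover have "walk w u (Suc i) = of_bool (u = drop (Suc i) w)" using Cons.prems by (intro Cons.IH) auto
  ultimately show ?case using i by (auto simp: hop_def d)
qed auto

text \<open>The infinitesimal form of orthogonality. Skew-symmetry of the letter representation makes
  \<open>\<langle>A x, y\<rangle> + \<langle>x, A y\<rangle>\<close> vanish; these are the two ways of placing the first letter.\<close>

lemma walk_unshuffle:
  assumes "u \<noteq> []"
  shows "(\<Sum>i\<le>length w. unshuffle_prod (\<lambda>u. walk w u i) (\<lambda>u. walk w u i) u) = 0"
proof -
  obtain r v where u: "u = r # v" using assms by (cases u) auto
  have "(\<Sum>i\<le>length w. unshuffle_prod (\<lambda>u. walk w u i) (\<lambda>u. walk w u i) u)
      = unshuffle_sum (\<lambda>s t. \<Sum>i\<le>length w. hop w r (walk w s) i * walk w t i + walk w s i * hop w r (walk w t) i) v"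
    unfolding u unshuffle_prod_def unshuffle_sum_Cons
    by (simp add: unshuffle_sum_sum unshuffle_sum_add sum.distrib)
  then show ?thesis by (simp add: hop_skew unshuffle_sum_def)
qed

text \<open>A shuffle character is sent to an orthogonal matrix, whose last column has norm \<open>1\<close>: by
  multiplicativity the sum of squares is again a pairing, and all its coefficients except that of
  the empty word vanish.\<close>

lemma sum_pairing_walk_squares:
  assumes c: "shuffle_character c" "entire c"
  shows "(\<Sum>i\<le>length w. (pairing k (\<lambda>u. walk w u i) c)\<^sup>2) = 1"
proof -
  let ?p = "\<lambda>i. unshuffle_prod (\<lambda>u. walk w u i) (\<lambda>u. walk w u i)"
  have sm: "summable (\<lambda>l. pair_deg k (?p i) c l)" for i
    by (rule summable_norm_cancel[OF summable_pair_deg])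
      (intro exp_bounded_unshuffle_prod exp_bounded_walk c)+
  have "(\<Sum>i\<le>length w. (pairing k (\<lambda>u. walk w u i) c)\<^sup>2) = (\<Sum>i\<le>length w. pairing k (?p i) c)"
    by (simp add: power2_eq_square pairing_mult c exp_bounded_walk)
  also have "\<dots> = suminf (\<lambda>l. \<Sum>i\<le>length w. pair_deg k (?p i) c l)"
    unfolding pairing_def by (rule suminf_sum[symmetric]) (rule sm)
  also have "(\<lambda>l. \<Sum>i\<le>length w. pair_deg k (?p i) c l) = (\<lambda>l. if l = 0 then 1 else 0)"
  proof
    fix l
    have "(\<Sum>i\<le>length w. pair_deg k (?p i) c l) = (\<Sum>u\<in>words k l. (\<Sum>i\<le>length w. ?p i u) * c u)"
      unfolding pair_deg_def sum_distrib_right by (rule sum.swap)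
    also have "\<dots> = (if l = 0 then 1 else 0)"
    proof (cases "l = 0")
      case True
      then show ?thesis using c(1) by (simp add: shuffle_character_def unshuffle_prod_def)
    next
      case False
      then have "u \<noteq> []" if "u \<in> words k l" for u using that by (auto simp: words_def)
      then show ?thesis using False by (simp add: walk_unshuffle)
    qed
    finally show "(\<Sum>i\<le>length w. pair_deg k (?p i) c l) = (if l = 0 then 1 else 0)" .
  qed
  also have "(suminf (\<lambda>l. if l = 0 then 1 else 0 :: real)) = 1"
    using sums_single[of 0 "\<lambda>_. 1 :: real"] by (simp add: sums_iff)
  finally show ?thesis .
qed

lemma abs_pairing_walk_le:
  assumes c: "shuffle_character c" "entire c" and i: "i \<le> length w"
  shows "\<bar>pairing k (\<lambda>u. walk w u i) c\<bar> \<le> 1"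
proof -
  have "(pairing k (\<lambda>u. walk w u i) c)\<^sup>2 \<le> (\<Sum>i\<le>length w. (pairing k (\<lambda>u. walk w u i) c)\<^sup>2)"
    by (rule member_le_sum) (use i in auto)
  then show ?thesis by (simp add: sum_pairing_walk_squares[OF c] abs_square_le_1)
qed

definition dilate :: "real \<Rightarrow> (nat list \<Rightarrow> real) \<Rightarrow> nat list \<Rightarrow> real" where
  "dilate t c w = t ^ length w * c w"

lemma pair_deg_dilate: "pair_deg k a (dilate t c) m = pair_deg k a c m * t ^ m"
  by (simp add: pair_deg_def dilate_def words_def sum_distrib_left sum_distrib_right mult_ac)

lemma pair_deg_dilate': "pair_deg k (dilate t a) c = pair_deg k a (dilate t c)"
  by (simp add: pair_deg_def dilate_def mult_ac fun_eq_iff)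

lemma pairing_dilate: "pairing k (dilate t a) c = pairing k a (dilate t c)"
  by (simp add: pairing_def pair_deg_dilate')

lemma exp_bounded_dilate:
  assumes "exp_bounded a" shows "exp_bounded (dilate t a)"
proof -
  from assms obtain C L where CL: "C \<ge> 0" "L > 0" "\<And>w. \<bar>a w\<bar> \<le> C * L ^ length w"
    by (auto simp: exp_bounded_def)
  have "\<bar>dilate t a w\<bar> \<le> C * ((\<bar>t\<bar> + 1) * L) ^ length w" for w
  proof -
    have "\<bar>dilate t a w\<bar> \<le> (\<bar>t\<bar> + 1) ^ length w * (C * L ^ length w)"
      unfolding dilate_def abs_mult power_abs by (intro mult_mono power_mono CL) auto
    then show ?thesis by (simp add: power_mult_distrib mult_ac)
  qed
  with CL show ?thesis unfolding exp_bounded_def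
    by (intro exI[of _ C] conjI exI[of _ "(\<bar>t\<bar> + 1) * L"]) auto
qed

text \<open>The shuffle relations are homogeneous in the length of words. Dilations replace the rescaling of the
  representation \<open>A\<close> to \<open>t A\<close>, so that the bound by \<open>1\<close> holds for all scales.\<close>

lemma shuffle_character_dilate:
  assumes "shuffle_character c" shows "shuffle_character (dilate t c)"
  using assms unfolding shuffle_character_def
proof (elim conjE, intro conjI allI impI)
  fix k and u v :: "nat list"
  assume *: "set u \<subseteq> {..<k}" "set v \<subseteq> {..<k}"
    and c: "\<forall>k u v. set u \<subseteq> {..<k} \<longrightarrow> set v \<subseteq> {..<k} \<longrightarrow> c u * c v =
       (\<Sum>w\<in>words k (length u + length v). c w * unshuffle_sum (word_pair u v) w)"
  have "dilate t c u * dilate t c v = t ^ (length u + length v) * (c u * c v)"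
    by (simp add: dilate_def power_add mult_ac)
  also have "c u * c v = (\<Sum>w\<in>words k (length u + length v). c w * unshuffle_sum (word_pair u v) w)"
    using c * by blast
  finally show "dilate t c u * dilate t c v =
       (\<Sum>w\<in>words k (length u + length v). dilate t c w * unshuffle_sum (word_pair u v) w)"
    by (simp add: sum_distrib_left dilate_def words_def mult_ac)
qed (simp add: dilate_def)

lemma entire_dilate:
  assumes "entire c" shows "entire (dilate t c)"
  unfolding entire_def
proof (intro allI impI)
  fix k and L :: real assume L: "L > 0"
  have "summable (\<lambda>m. \<Sum>w\<in>words k m. (L * (\<bar>t\<bar> + 1)) ^ m * \<bar>c w\<bar>)"
    using assms L by (auto simp: entire_def)
  then show "summable (\<lambda>m. \<Sum>w\<in>words k m. L ^ m * \<bar>dilate t c w\<bar>)"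
  proof (rule summable_comparison_test'[where N=0])
    fix n
    have "L ^ n * (\<bar>t\<bar> ^ n * \<bar>c w\<bar>) \<le> L ^ n * ((\<bar>t\<bar> + 1) ^ n * \<bar>c w\<bar>)" for w
      using L by (intro mult_left_mono mult_right_mono power_mono) auto
    then show "norm (\<Sum>w\<in>words k n. L ^ n * \<bar>dilate t c w\<bar>) \<le> (\<Sum>w\<in>words k n. (L * (\<bar>t\<bar> + 1)) ^ n * \<bar>c w\<bar>)"
      using L unfolding real_norm_def
      by (subst abs_of_nonneg) (auto intro!: sum_nonneg sum_mono simp: dilate_def words_def abs_mult power_abs power_mult_distrib mult.assoc)
  qed
qed

text \<open>As a power series in the scale \<open>t\<close> the matrix entry between the first and the last site begins
  with \<open>c w * t ^ length w\<close>: shorter words do not reach the last site, and of the words of the same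
  length only \<open>w\<close> does. Hence the bounded functionals determine the coordinates.\<close>

lemma walk_pairing_recovers:
  assumes c: "entire c" and w: "set w \<subseteq> {..<k}"
  shows "((\<lambda>t. pairing k (\<lambda>u. walk w u 0) (dilate t c) / t ^ length w) \<longlongrightarrow> c w) (at 0)"
proof -
  define n where "n = length w"
  define b where "b = pair_deg k (\<lambda>u. walk w u 0) c"
  have b0: "b m = 0" if "m < n" for m
    using that by (auto simp: b_def pair_deg_def n_def words_def walk_short)
  have wn: "w \<in> words k n" using w by (simp add: words_def n_def)
  have "b n = (\<Sum>u\<in>words k n. if u = w then c u else 0)"
    unfolding b_def pair_deg_def
    by (intro sum.cong refl) (auto simp: walk_exact words_def n_def)
  then have bn: "b n = c w" using wn by simp
  have summ: "summable (\<lambda>m. b m * t ^ m)" for t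
    using summable_norm_cancel[OF summable_pair_deg[OF exp_bounded_walk entire_dilate[OF c]]]
    by (simp add: b_def pair_deg_dilate)
  have "((\<lambda>t. suminf (\<lambda>m. b (m + n) * t ^ m)) \<longlongrightarrow> b (0 + n)) (at 0)"
  proof (rule powser_limit_0[where s=1])
    fix t :: real
    have "summable (\<lambda>m. b (m + n) * t ^ m)"
    proof (cases "t = 0")
      case True
      then show ?thesis by (simp add: power_0_left if_distrib[of "\<lambda>x. _ * x"] cong: if_cong)
    next
      case False
      have "summable (\<lambda>m. b (m + n) * t ^ (m + n))" using summ[of t] by (subst summable_iff_shift)
      from summable_mult2[OF this, of "1 / t ^ n"] False show ?thesis by (simp add: power_add)
    qed
    then show "(\<lambda>m. b (m + n) * t ^ m) sums (suminf (\<lambda>m. b (m + n) * t ^ m))" by (rule summable_sums)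
  qed simp
  moreover have "eventually (\<lambda>t. (suminf (\<lambda>m. b (m + n) * t ^ m)) =
      pairing k (\<lambda>u. walk w u 0) (dilate t c) / t ^ length w) (at 0)"
  proof (rule eventually_at_topological[THEN iffD2], intro exI[of _ UNIV] conjI ballI impI)
    fix t :: real assume t: "t \<noteq> 0"
    have "pairing k (\<lambda>u. walk w u 0) (dilate t c) = suminf (\<lambda>m. b m * t ^ m)"
      by (simp add: pairing_def b_def pair_deg_dilate)
    also have "\<dots> = suminf (\<lambda>m. b (m + n) * t ^ (m + n))"
      using suminf_split_initial_segment[OF summ, of t n] b0 by simp
    also have "\<dots> = (suminf (\<lambda>m. (b (m + n) * t ^ (m + n)) / t ^ n)) * t ^ n"
      using suminf_divide[of "\<lambda>m. b (m + n) * t ^ (m + n)" "t ^ n"] summ[of t] t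
      by (simp add: summable_iff_shift[of "\<lambda>m. b m * t ^ m"])
    finally show "(suminf (\<lambda>m. b (m + n) * t ^ m)) = pairing k (\<lambda>u. walk w u 0) (dilate t c) / t ^ length w"
      using t by (simp add: n_def power_add)
  qed auto
  ultimately show ?thesis using bn by (simp add: Lim_transform_eventually)
qed

section \<open>Change of alphabet\<close>

text \<open>Functionals over different alphabets are multiplied after moving both to the larger one.\<close>

definition restrict_letters :: "nat \<Rightarrow> (nat list \<Rightarrow> real) \<Rightarrow> nat list \<Rightarrow> real" where
  "restrict_letters k a w = (if set w \<subseteq> {..<k} then a w else 0)"

lemma exp_bounded_restrict: "exp_bounded a \<Longrightarrow> exp_bounded (restrict_letters k a)"
  unfolding exp_bounded_def restrict_letters_def by fastforce

lemma pairing_restrict: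
  assumes "k \<le> k'"
  shows "pairing k' (restrict_letters k a) c = pairing k a c"
proof -
  have "pair_deg k' (restrict_letters k a) c m = pair_deg k a c m" for m
    unfolding pair_deg_def
    by (rule sum.mono_neutral_cong_right[OF finite_words])
      (use assms in \<open>auto simp: words_def restrict_letters_def\<close>)
  then show ?thesis by (simp add: pairing_def)
qed

section \<open>Grading by the number of nodes\<close>

definition forest_nodes :: "'d forest \<Rightarrow> nat" where
  "forest_nodes \<sigma> = sum_mset (image_mset nodes \<sigma>)"

lemma forest_nodes_simps [simp]:
  "forest_nodes {#} = 0" "forest_nodes (\<sigma> + \<rho>) = forest_nodes \<sigma> + forest_nodes \<rho>"
  "forest_nodes {#t#} = nodes t" "forest_nodes (add_mset t \<sigma>) = nodes t + forest_nodes \<sigma>"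
  by (simp_all add: forest_nodes_def)

lemma nodes_pos: "0 < nodes t"
  by (cases t) simp

lemma nodes_Root: "nodes (Root i ts) = Suc (forest_nodes ts)"
  by (simp add: forest_nodes_def)

lemma size_le_forest_nodes: "size \<sigma> \<le> forest_nodes \<sigma>"
proof (induction \<sigma>)
  case (add t \<sigma>)
  then show ?case using nodes_pos[of t] by simp
qed simp

lemma nodes_le_forest_nodes: "t \<in># \<sigma> \<Longrightarrow> nodes t \<le> forest_nodes \<sigma>"
  by (auto dest!: multi_member_split)

lemma finite_multisets_bounded:
  assumes "finite A"
  shows "finite {M. set_mset M \<subseteq> A \<and> size M \<le> n}"
proof (rule finite_subset)
  show "finite (mset ` {xs. set xs \<subseteq> A \<and> length xs \<le> n})"
    using assms by (intro finite_imageI finite_lists_length_le)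
  show "{M. set_mset M \<subseteq> A \<and> size M \<le> n} \<subseteq> mset ` {xs. set xs \<subseteq> A \<and> length xs \<le> n}"
  proof
    fix M assume M: "M \<in> {M. set_mset M \<subseteq> A \<and> size M \<le> n}"
    obtain xs where "M = mset xs" by (metis ex_mset)
    with M show "M \<in> mset ` {xs. set xs \<subseteq> A \<and> length xs \<le> n}" by auto
  qed
qed

lemma finite_forests_of_trees:
  assumes "finite {t :: 'd rtree. nodes t \<le> n}"
  shows "finite {\<sigma> :: 'd forest. forest_nodes \<sigma> \<le> n}"
  by (rule finite_subset[OF _ finite_multisets_bounded[OF assms, of n]])
    (use size_le_forest_nodes nodes_le_forest_nodes order_trans in blast)

text \<open>A tree with at most \<open>n + 1\<close> nodes is a label together with a forest of at most \<open>n\<close> nodes.\<close>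

lemma finite_trees: "finite {t :: 'd::finite rtree. nodes t \<le> n}"
proof (induction n)
  case 0
  have "{t :: 'd rtree. nodes t \<le> 0} = {}" using nodes_pos by (metis (no_types, lifting) Collect_empty_eq leD)
  then show ?case by (simp only: finite.emptyI)
next
  case (Suc n)
  have "{t :: 'd rtree. nodes t \<le> Suc n} \<subseteq> (\<lambda>(i, ts). Root i ts) ` (UNIV \<times> {\<sigma>. forest_nodes \<sigma> \<le> n})"
  proof
    fix t :: "'d rtree" assume "t \<in> {t. nodes t \<le> Suc n}"
    then show "t \<in> (\<lambda>(i, ts). Root i ts) ` (UNIV \<times> {\<sigma>. forest_nodes \<sigma> \<le> n})"
      by (cases t) (auto simp del: nodes.simps simp: nodes_Root)
  qed
  then show ?case
    by (rule finite_subset) (intro finite_imageI finite_cartesian_product finite finite_forests_of_trees[OF Suc])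
qed

definition forests :: "nat \<Rightarrow> 'd forest set" where
  "forests n = {\<sigma>. forest_nodes \<sigma> = n}"

lemma finite_forests [simp]: "finite (forests n :: 'd::finite forest set)"
  by (rule finite_subset[OF _ finite_forests_of_trees[OF finite_trees, of n]]) (auto simp: forests_def)

definition homogeneous :: "nat \<Rightarrow> (('d forest \<times> 'd forest) \<Rightarrow>\<^sub>0 real) \<Rightarrow> bool" where
  "homogeneous n p \<longleftrightarrow> (\<forall>(\<sigma>, \<rho>)\<in>Poly_Mapping.keys p. forest_nodes \<sigma> + forest_nodes \<rho> = n)"

lemma homogeneous_mult:
  assumes "homogeneous m p" "homogeneous n q"
  shows "homogeneous (m + n) (p * q)"
  unfolding homogeneous_def
proof (clarify)
  fix \<sigma> \<rho> assume "(\<sigma>, \<rho>) \<in> Poly_Mapping.keys (p * q)"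
  then obtain x y where "x \<in> Poly_Mapping.keys p" "y \<in> Poly_Mapping.keys q" "(\<sigma>, \<rho>) = x + y"
    using keys_mult[of p q] by blast
  with assms show "forest_nodes \<sigma> + forest_nodes \<rho> = m + n"
    by (cases x; cases y) (fastforce simp: homogeneous_def)
qed

lemma homogeneous_prod_mset:
  assumes "\<And>t. t \<in># ts \<Longrightarrow> homogeneous (nodes t) (f t)"
  shows "homogeneous (forest_nodes ts) (prod_mset (image_mset f ts))"
  using assms
proof (induction ts)
  case empty
  show ?case by (simp add: homogeneous_def zero_prod_def)
next
  case (add t ts)
  then show ?case using homogeneous_mult[of "nodes t" "f t"] by simp
qed

lemma homogeneous_CK_tree: "homogeneous (nodes t) (CK_tree t)"
proof (induction t)
  case (Root i ts)
  have h: "homogeneous (forest_nodes ts) (prod_mset (image_mset CK_tree ts))"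
    by (rule homogeneous_prod_mset) (use Root in auto)
  show ?case
    unfolding homogeneous_def
  proof clarify
    fix \<sigma> \<rho> assume "(\<sigma>, \<rho>) \<in> Poly_Mapping.keys (CK_tree (Root i ts))"
    then have "(\<sigma>, \<rho>) \<in> Poly_Mapping.keys (Poly_Mapping.single ({#Root i ts#}, 0 :: 'a forest) (1::real)) \<union>
       Poly_Mapping.keys (id_tensor_Bplus i (prod_mset (image_mset CK_tree ts)))"
      using Poly_Mapping.keys_add by (fastforce simp del: nodes.simps)
    then show "forest_nodes \<sigma> + forest_nodes \<rho> = nodes (Root i ts)"
    proof
      assume "(\<sigma>, \<rho>) \<in> Poly_Mapping.keys (id_tensor_Bplus i (prod_mset (image_mset CK_tree ts)))"
      then have "(\<sigma>, \<rho>) \<in> (\<Union>p\<in>Poly_Mapping.keys (prod_mset (image_mset CK_tree ts)).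
          Poly_Mapping.keys (case p of (\<sigma>1, \<sigma>2) \<Rightarrow> Poly_Mapping.single (\<sigma>1, {#Root i \<sigma>2#})
            (Poly_Mapping.lookup (prod_mset (image_mset CK_tree ts)) (\<sigma>1, \<sigma>2))))"
        unfolding id_tensor_Bplus_def by (rule subsetD[OF keys_sum])
      then show ?thesis
        using h by (auto simp: homogeneous_def nodes_Root simp del: nodes.simps split: if_splits)
    qed (auto simp: nodes_Root simp del: nodes.simps)
  qed
qed

text \<open>The Connes--Kreimer coproduct distributes the nodes of a forest over the two factors, so its
  dual, the Grossman--Larson product, is graded.\<close>

lemma homogeneous_CK: "homogeneous (forest_nodes \<sigma>) (CK \<sigma>)"
  unfolding CK_def by (rule homogeneous_prod_mset) (rule homogeneous_CK_tree)

definition word_nodes :: "(nat \<Rightarrow> 'd rtree) \<Rightarrow> nat list \<Rightarrow> nat" where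
  "word_nodes \<tau> w = (\<Sum>r\<leftarrow>w. nodes (\<tau> r))"

lemma word_nodes_mset: "word_nodes \<tau> w = sum_mset (image_mset (\<lambda>r. nodes (\<tau> r)) (mset w))"
  by (simp add: word_nodes_def sum_mset_sum_list[symmetric])

text \<open>This is what makes the expansion of a series locally finite: only words with the right number of
  nodes contribute to the coefficient of a forest.\<close>

lemma GL_word_eq_0: "forest_nodes \<sigma> \<noteq> word_nodes \<tau> w \<Longrightarrow> GL_word \<tau> w \<sigma> = 0"
proof (induction w arbitrary: \<sigma>)
  case (Cons r w)
  show ?case
    unfolding GL_word.simps GL_def
  proof (intro sum.neutral ballI, clarify)
    fix \<sigma>1 \<sigma>2 assume "(\<sigma>1, \<sigma>2) \<in> Poly_Mapping.keys (CK \<sigma>)"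
    then have "forest_nodes \<sigma>1 + forest_nodes \<sigma>2 = forest_nodes \<sigma>"
      using homogeneous_CK[of \<sigma>] by (auto simp: homogeneous_def)
    with Cons show "Poly_Mapping.lookup (CK \<sigma>) (\<sigma>1, \<sigma>2) * basis {#\<tau> r#} \<sigma>1 * GL_word \<tau> w \<sigma>2 = 0"
      by (auto simp: word_nodes_def basis_def)
  qed
qed (auto simp: basis_def word_nodes_def)

definition words_of_nodes :: "(nat \<Rightarrow> 'd rtree) \<Rightarrow> nat \<Rightarrow> nat list set" where
  "words_of_nodes \<tau> n = {w. word_nodes \<tau> w = n}"

lemma finite_words_of_nodes [simp]:
  fixes \<tau> :: "nat \<Rightarrow> 'd::finite rtree"
  assumes "inj \<tau>"
  shows "finite (words_of_nodes \<tau> n)"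
proof (rule finite_subset)
  have "finite {r. nodes (\<tau> r) \<le> n}"
    using finite_vimageI[OF finite_trees assms, of n] by (simp add: vimage_def)
  then show "finite {w. set w \<subseteq> {r. nodes (\<tau> r) \<le> n} \<and> length w \<le> n}"
    by (rule finite_lists_length_le)
  have "set w \<subseteq> {r. nodes (\<tau> r) \<le> word_nodes \<tau> w}" for w
    by (auto simp: word_nodes_def intro!: member_le_sum_list)
  moreover have "length w \<le> word_nodes \<tau> w" for w
  proof (induction w)
    case (Cons r w)
    then show ?case using nodes_pos[of "\<tau> r"] by (simp add: word_nodes_def)
  qed (simp add: word_nodes_def)
  ultimately show "words_of_nodes \<tau> n \<subseteq> {w. set w \<subseteq> {r. nodes (\<tau> r) \<le> n} \<and> length w \<le> n}"
    by (auto simp: words_of_nodes_def)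
qed

section \<open>Coordinates in the free generators\<close>

lemma T_to_H_superset:
  assumes "finite A" "Poly_Mapping.keys p \<subseteq> A"
  shows "T_to_H \<tau> p \<sigma> = (\<Sum>w\<in>A. Poly_Mapping.lookup p w * GL_word \<tau> w \<sigma>)"
  unfolding T_to_H_def using assms by (intro sum.mono_neutral_left) (auto simp: in_keys_iff)

text \<open>The coordinates of a single forest in the free basis.\<close>

definition dual_coeff :: "(nat \<Rightarrow> 'd rtree) \<Rightarrow> 'd forest \<Rightarrow> nat list \<Rightarrow> real" where
  "dual_coeff \<tau> \<sigma> = Poly_Mapping.lookup (inv (T_to_H \<tau>) (basis \<sigma>))"

lemma has_sum_series_iff:
  fixes \<tau> :: "nat \<Rightarrow> 'd::finite rtree"
  assumes "inj \<tau>"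
  shows "((\<lambda>w. c w * GL_word \<tau> w \<sigma>) has_sum s) UNIV \<longleftrightarrow>
     (\<Sum>w\<in>words_of_nodes \<tau> (forest_nodes \<sigma>). c w * GL_word \<tau> w \<sigma>) = s"
proof -
  have "((\<lambda>w. c w * GL_word \<tau> w \<sigma>) has_sum s) UNIV \<longleftrightarrow>
     ((\<lambda>w. c w * GL_word \<tau> w \<sigma>) has_sum s) (words_of_nodes \<tau> (forest_nodes \<sigma>))"
    by (rule has_sum_cong_neutral) (auto simp: words_of_nodes_def GL_word_eq_0)
  also have "\<dots> \<longleftrightarrow> (\<Sum>w\<in>words_of_nodes \<tau> (forest_nodes \<sigma>). c w * GL_word \<tau> w \<sigma>) = s"
    using has_sum_finite_iff[OF finite_words_of_nodes[OF assms]] by (auto simp: eq_commute)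
  finally show ?thesis .
qed

context
  fixes \<tau> :: "nat \<Rightarrow> 'd::finite rtree"
  assumes free: "free_generators \<tau>"
begin

lemma inj_generators: "inj \<tau>"
  using free by (simp add: free_generators_def)

lemma bij_T_to_H: "bij_betw (T_to_H \<tau>) UNIV H"
  using free by (simp add: free_generators_def T_to_H_Hopf_iso_def)

lemma basis_in_H: "basis \<sigma> \<in> H"
  by (simp add: H_def basis_def)

lemma T_to_H_inv_basis: "T_to_H \<tau> (inv (T_to_H \<tau>) (basis \<sigma>)) = basis \<sigma>"
  using bij_betw_inv_into_right[OF bij_T_to_H basis_in_H] .

lemma sum_dual_coeff_GL_word:
  "(\<Sum>w\<in>words_of_nodes \<tau> (forest_nodes \<rho>). dual_coeff \<tau> \<sigma> w * GL_word \<tau> w \<rho>) = basis \<sigma> \<rho>"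
proof -
  let ?p = "inv (T_to_H \<tau>) (basis \<sigma>)"
  let ?W = "words_of_nodes \<tau> (forest_nodes \<rho>)"
  have "basis \<sigma> \<rho> = (\<Sum>w\<in>Poly_Mapping.keys ?p \<union> ?W. dual_coeff \<tau> \<sigma> w * GL_word \<tau> w \<rho>)"
    unfolding dual_coeff_def
    by (subst T_to_H_superset[symmetric]) (auto simp: inj_generators T_to_H_inv_basis)
  also have "\<dots> = (\<Sum>w\<in>?W. dual_coeff \<tau> \<sigma> w * GL_word \<tau> w \<rho>)"
    by (rule sum.mono_neutral_right)
      (simp_all add: inj_generators GL_word_eq_0 words_of_nodes_def[of \<tau> "forest_nodes \<rho>"]
        finite_words_of_nodes[unfolded words_of_nodes_def])
  finally show ?thesis by simp
qed

text \<open>In each degree the difference of two expansions is a noncommutative polynomial, and the tensor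
  algebra is mapped injectively.\<close>

lemma expansion_unique:
  assumes "\<And>\<sigma>. (\<Sum>w\<in>words_of_nodes \<tau> (forest_nodes \<sigma>). c w * GL_word \<tau> w \<sigma>) =
     (\<Sum>w\<in>words_of_nodes \<tau> (forest_nodes \<sigma>). c' w * GL_word \<tau> w \<sigma>)"
  shows "c = c'"
proof
  fix w
  let ?n = "word_nodes \<tau> w"
  let ?W = "words_of_nodes \<tau> ?n"
  \<comment> \<open>The part of the difference in the degree of \<open>w\<close>.\<close>
  define p where "p = Abs_poly_mapping (\<lambda>u. (c u - c' u) when u \<in> ?W)"
  have fin: "finite {u. ((c u - c' u) when u \<in> ?W) \<noteq> 0}"
    by (rule finite_subset[OF _ finite_words_of_nodes[OF inj_generators, of ?n]]) (auto simp: when_def)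
  have p: "Poly_Mapping.lookup p u = (if u \<in> ?W then c u - c' u else 0)" for u
    unfolding p_def using fin by (simp add: Abs_poly_mapping_inverse when_def)
  have "T_to_H \<tau> p \<sigma> = 0" for \<sigma>
  proof -
    have "T_to_H \<tau> p \<sigma> = (\<Sum>u\<in>?W. (c u - c' u) * GL_word \<tau> u \<sigma>)"
      by (subst T_to_H_superset[of ?W]) (auto simp: inj_generators p in_keys_iff split: if_splits)
    also have "\<dots> = 0"
    proof (cases "forest_nodes \<sigma> = ?n")
      case True
      then show ?thesis using assms[of \<sigma>] by (simp add: left_diff_distrib sum_subtractf)
    next
      case False
      then show ?thesis by (intro sum.neutral) (auto simp: GL_word_eq_0 words_of_nodes_def)
    qed
    finally show ?thesis .
  qed
  then have "T_to_H \<tau> p = T_to_H \<tau> 0" by (auto simp: T_to_H_def)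
  then have "p = 0" using bij_T_to_H by (auto simp: bij_betw_def dest: injD)
  then show "c w = c' w" using p[of w] by (simp add: words_of_nodes_def)
qed

text \<open>Inserting the expansions of single forests degree by degree gives an expansion of any series.\<close>

lemma sum_dual_coeff_expansion:
  "(\<Sum>w\<in>words_of_nodes \<tau> (forest_nodes \<rho>).
      (\<Sum>\<sigma>\<in>forests (word_nodes \<tau> w). h \<sigma> * dual_coeff \<tau> \<sigma> w) * GL_word \<tau> w \<rho>) = h \<rho>"
proof -
  have "(\<Sum>w\<in>words_of_nodes \<tau> (forest_nodes \<rho>).
      (\<Sum>\<sigma>\<in>forests (word_nodes \<tau> w). h \<sigma> * dual_coeff \<tau> \<sigma> w) * GL_word \<tau> w \<rho>) =
    (\<Sum>w\<in>words_of_nodes \<tau> (forest_nodes \<rho>). \<Sum>\<sigma>\<in>forests (forest_nodes \<rho>). h \<sigma> * (dual_coeff \<tau> \<sigma> w * GL_word \<tau> w \<rho>))"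
    by (intro sum.cong refl) (simp add: words_of_nodes_def sum_distrib_right mult.assoc)
  also have "\<dots> = (\<Sum>\<sigma>\<in>forests (forest_nodes \<rho>). h \<sigma> * basis \<sigma> \<rho>)"
    by (subst sum.swap) (simp add: sum_distrib_left[symmetric] sum_dual_coeff_GL_word)
  also have "\<dots> = (\<Sum>\<sigma>\<in>forests (forest_nodes \<rho>). if \<sigma> = \<rho> then h \<sigma> else 0)"
    by (intro sum.cong) (auto simp: basis_def)
  also have "\<dots> = h \<rho>" by (simp add: forests_def[of "forest_nodes \<rho>"] finite_forests[unfolded forests_def])
  finally show ?thesis .
qed

lemma expansion_eqI:
  assumes "\<And>\<sigma>. (\<Sum>w\<in>words_of_nodes \<tau> (forest_nodes \<sigma>). c w * GL_word \<tau> w \<sigma>) = h \<sigma>"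
  shows "expansion \<tau> h = c"
  unfolding expansion_def has_sum_series_iff[OF inj_generators]
  by (rule the_equality) (use assms in \<open>auto intro!: expansion_unique\<close>)

text \<open>Each coordinate is a finite linear combination of coefficients of the series. Linearity of
  the coordinates and their compatibility with expectations are immediate from this form.\<close>

lemma expansion_eq: "expansion \<tau> h w = (\<Sum>\<sigma>\<in>forests (word_nodes \<tau> w). h \<sigma> * dual_coeff \<tau> \<sigma> w)"
  using expansion_eqI[OF sum_dual_coeff_expansion] by simp

lemma sum_expansion: "(\<Sum>w\<in>words_of_nodes \<tau> (forest_nodes \<rho>). expansion \<tau> h w * GL_word \<tau> w \<rho>) = h \<rho>"
  unfolding expansion_eq by (rule sum_dual_coeff_expansion)

lemma expansion_diff: "expansion \<tau> (\<lambda>\<sigma>. h \<sigma> - h' \<sigma>) w = expansion \<tau> h w - expansion \<tau> h' w"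
  by (simp add: expansion_eq left_diff_distrib sum_subtractf)

lemma expansion_finite:
  assumes "finite S"
  shows "expansion \<tau> (\<lambda>\<sigma>. \<Sum>w\<in>S. q w * GL_word \<tau> w \<sigma>) = (\<lambda>w. if w \<in> S then q w else 0)"
proof (rule expansion_eqI)
  fix \<sigma>
  have "(\<Sum>w\<in>words_of_nodes \<tau> (forest_nodes \<sigma>). (if w \<in> S then q w else 0) * GL_word \<tau> w \<sigma>) =
      (\<Sum>w\<in>words_of_nodes \<tau> (forest_nodes \<sigma>) \<inter> S. q w * GL_word \<tau> w \<sigma>)"
    by (subst sum.inter_restrict) (auto simp: inj_generators intro!: sum.cong)
  also have "\<dots> = (\<Sum>w\<in>S. q w * GL_word \<tau> w \<sigma>)"
  proof (rule sum.mono_neutral_left)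
    show "\<forall>w\<in>S - words_of_nodes \<tau> (forest_nodes \<sigma>) \<inter> S. q w * GL_word \<tau> w \<sigma> = 0"
    proof
      fix w assume "w \<in> S - words_of_nodes \<tau> (forest_nodes \<sigma>) \<inter> S"
      then have "forest_nodes \<sigma> \<noteq> word_nodes \<tau> w" by (auto simp: words_of_nodes_def)
      then show "q w * GL_word \<tau> w \<sigma> = 0" by (simp add: GL_word_eq_0)
    qed
  qed (auto simp: assms)
  finally show "(\<Sum>w\<in>words_of_nodes \<tau> (forest_nodes \<sigma>). (if w \<in> S then q w else 0) * GL_word \<tau> w \<sigma>) =
      (\<Sum>w\<in>S. q w * GL_word \<tau> w \<sigma>)" .
qed

lemma expansion_GL_word: "expansion \<tau> (GL_word \<tau> u) w = of_bool (w = u)"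
  using expansion_finite[of "{u}" "\<lambda>_. 1"] by simp

section \<open>Coordinates of group elements\<close>

text \<open>Compatibility of the isomorphism with the coproducts, evaluated at a pair of forests.\<close>

lemma GL_word_add:
  "GL_word \<tau> w (\<sigma> + \<rho>) = unshuffle_sum (\<lambda>u v. GL_word \<tau> u \<sigma> * GL_word \<tau> v \<rho>) w"
proof -
  let ?p = "Poly_Mapping.single w (1 :: real)"
  let ?s = "\<lambda>I. (nths w I, nths w (- I))"
  let ?P = "Pow {..<length w}"
  let ?g = "\<lambda>(u, v). GL_word \<tau> u \<sigma> * GL_word \<tau> v \<rho>"
  have cop: "T_coprod ?p = (\<Sum>I\<in>?P. Poly_Mapping.single (?s I) 1)"
    by (simp add: T_coprod_def)
  have keys: "Poly_Mapping.keys (T_coprod ?p) \<subseteq> ?s ` ?P"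
    unfolding cop by (rule order_trans[OF keys_sum]) (auto split: if_splits)
  have "GL_word \<tau> w (\<sigma> + \<rho>) = delta (T_to_H \<tau> ?p) (\<sigma>, \<rho>)"
    by (simp add: delta_apply T_to_H_def)
  also have "delta (T_to_H \<tau> ?p) = T_to_H2 \<tau> (T_coprod ?p)"
    using free by (simp add: free_generators_def T_to_H_Hopf_iso_def)
  also have "T_to_H2 \<tau> (T_coprod ?p) (\<sigma>, \<rho>) = (\<Sum>q\<in>?s ` ?P. Poly_Mapping.lookup (T_coprod ?p) q * ?g q)"
    unfolding T_to_H2_def prod.case using keys
    by (intro sum.mono_neutral_cong_left) (auto simp: in_keys_iff mult.assoc split: prod.splits)
  also have "\<dots> = (\<Sum>q\<in>?s ` ?P. \<Sum>I\<in>?P. if ?s I = q then ?g q else 0)"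
    unfolding cop lookup_sum sum_distrib_right
    by (intro sum.cong refl) (auto simp: lookup_single when_def)
  also have "\<dots> = (\<Sum>I\<in>?P. ?g (?s I))"
    by (subst sum.swap) (intro sum.cong refl, simp)
  finally show ?thesis by (simp add: unshuffle_sum_def)
qed

text \<open>A product of generators is its own expansion, so the two families of coefficients are inverse to
  each other on either side.\<close>

lemma sum_GL_word_dual_coeff:
  "(\<Sum>\<sigma>\<in>forests (word_nodes \<tau> w). GL_word \<tau> u \<sigma> * dual_coeff \<tau> \<sigma> w) = of_bool (u = w)"
  using expansion_GL_word[of u w] by (auto simp: expansion_eq)

text \<open>By group-likeness \<open>c u * c v\<close> pairs \<open>g (\<sigma> + \<rho>)\<close> with the dual coefficients of \<open>u\<close> and \<open>v\<close>. Expanding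
  \<open>g\<close> in words at \<open>\<sigma> + \<rho>\<close> brings in the coproduct of the tensor algebra, and the dual coefficients
  select the splittings into \<open>u\<close> and \<open>v\<close>. The expansion sums over words with a given number of nodes, the
  shuffle relation over words of a given length and alphabet; both sets contain all shuffles.\<close>

lemma shuffle_character_expansion:
  assumes "g \<in> Gstar"
  shows "shuffle_character (expansion \<tau> g)"
proof -
  let ?c = "expansion \<tau> g"
  have g_add: "g (\<sigma> + \<rho>) = g \<sigma> * g \<rho>" for \<sigma> \<rho>
  proof -
    have "delta g (\<sigma>, \<rho>) = g \<sigma> * g \<rho>" using assms by (simp add: Gstar_def)
    then show ?thesis by (simp add: delta_apply)
  qed
  obtain \<sigma> where "g \<sigma> \<noteq> 0" using assms by (auto simp: Gstar_def fun_eq_iff)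
  then have g0: "g 0 = 1" using g_add[of \<sigma> 0] by simp
  have W0: "words_of_nodes \<tau> 0 = {[]}"
  proof -
    have "w = []" if "word_nodes \<tau> w = 0" for w
      using that nodes_pos[of "\<tau> (hd w)"] by (cases w) (auto simp: word_nodes_def)
    then show ?thesis by (auto simp: words_of_nodes_def word_nodes_def)
  qed
  have "?c [] = 1"
    using sum_expansion[of g 0] g0 by (simp add: W0 basis_def)
  moreover have "?c u * ?c v = (\<Sum>w\<in>words k (length u + length v). ?c w * unshuffle_sum (word_pair u v) w)"
    if uv: "set u \<subseteq> {..<k}" "set v \<subseteq> {..<k}" for k u v
  proof -
    let ?W = "words_of_nodes \<tau> (word_nodes \<tau> u + word_nodes \<tau> v)"
    let ?F = "forests (word_nodes \<tau> u)" and ?F' = "forests (word_nodes \<tau> v)"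
    let ?d = "dual_coeff \<tau>"
    have "?c u * ?c v = (\<Sum>\<sigma>\<in>?F. \<Sum>\<rho>\<in>?F'. g (\<sigma> + \<rho>) * (?d \<sigma> u * ?d \<rho> v))"
      by (simp add: expansion_eq sum_product g_add mult_ac)
    also have "\<dots> = (\<Sum>\<sigma>\<in>?F. \<Sum>\<rho>\<in>?F'. \<Sum>w\<in>?W. ?c w * (?d \<sigma> u * ?d \<rho> v * GL_word \<tau> w (\<sigma> + \<rho>)))"
    proof (intro sum.cong refl)
      fix \<sigma> \<rho> :: "'d forest" assume "\<sigma> \<in> ?F" "\<rho> \<in> ?F'"
      then have "forest_nodes (\<sigma> + \<rho>) = word_nodes \<tau> u + word_nodes \<tau> v" by (simp add: forests_def)
      then show "g (\<sigma> + \<rho>) * (?d \<sigma> u * ?d \<rho> v) = (\<Sum>w\<in>?W. ?c w * (?d \<sigma> u * ?d \<rho> v * GL_word \<tau> w (\<sigma> + \<rho>)))"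
        using sum_expansion[of g "\<sigma> + \<rho>", symmetric]
        by (simp add: sum_distrib_left sum_distrib_right mult_ac)
    qed
    also have "\<dots> = (\<Sum>w\<in>?W. ?c w * (\<Sum>\<sigma>\<in>?F. \<Sum>\<rho>\<in>?F'. ?d \<sigma> u * ?d \<rho> v * GL_word \<tau> w (\<sigma> + \<rho>)))"
      unfolding sum_distrib_left by (subst sum.swap[of _ ?W], subst sum.swap[of _ ?W]) (rule refl)
    also have "\<dots> = (\<Sum>w\<in>?W. ?c w * unshuffle_sum (word_pair u v) w)"
    proof (intro sum.cong refl arg_cong2[where f="(*)"])
      fix w
      have "(\<Sum>\<sigma>\<in>?F. \<Sum>\<rho>\<in>?F'. ?d \<sigma> u * ?d \<rho> v * GL_word \<tau> w (\<sigma> + \<rho>)) =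
        unshuffle_sum (\<lambda>s t. (\<Sum>\<sigma>\<in>?F. GL_word \<tau> s \<sigma> * ?d \<sigma> u) * (\<Sum>\<rho>\<in>?F'. GL_word \<tau> t \<rho> * ?d \<rho> v)) w"
        by (simp add: GL_word_add unshuffle_sum_sum[symmetric] unshuffle_sum_cmult[symmetric] sum_product mult_ac)
      also have "\<dots> = unshuffle_sum (word_pair u v) w"
        by (simp add: sum_GL_word_dual_coeff word_pair_def[abs_def] of_bool_conj)
      finally show "(\<Sum>\<sigma>\<in>?F. \<Sum>\<rho>\<in>?F'. ?d \<sigma> u * ?d \<rho> v * GL_word \<tau> w (\<sigma> + \<rho>)) = unshuffle_sum (word_pair u v) w" .
    qed
    finally have cc: "?c u * ?c v = (\<Sum>w\<in>?W. ?c w * unshuffle_sum (word_pair u v) w)" .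
    have zero: "?c w * unshuffle_sum (word_pair u v) w = 0"
      if "w \<notin> ?W \<inter> words k (length u + length v)" for w
    proof -
      have "mset u + mset v \<noteq> mset w"
      proof
        assume *: "mset u + mset v = mset w"
        have "set u \<union> set v = set w" "length u + length v = length w"
            "word_nodes \<tau> u + word_nodes \<tau> v = word_nodes \<tau> w"
          by (metis * set_mset_mset set_mset_union) (metis * size_mset size_union,
            metis * word_nodes_mset image_mset_union sum_mset.union)
        with that uv show False by (auto simp: words_of_nodes_def words_def)
      qed
      then have "unshuffle_sum (word_pair u v) w = 0"
        by (intro unshuffle_sum_eq_0) (auto simp: word_pair_def)
      then show ?thesis by simp
    qed
    have "(\<Sum>w\<in>?W. ?c w * unshuffle_sum (word_pair u v) w) = (\<Sum>w\<in>?W \<inter> words k (length u + length v). ?c w * unshuffle_sum (word_pair u v) w)"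
    proof (rule sum.mono_neutral_right)
      show "\<forall>w\<in>?W - ?W \<inter> words k (length u + length v). ?c w * unshuffle_sum (word_pair u v) w = 0"
        using zero by blast
    qed (auto simp: inj_generators)
    also have "\<dots> = (\<Sum>w\<in>words k (length u + length v). ?c w * unshuffle_sum (word_pair u v) w)"
    proof (rule sum.mono_neutral_left)
      show "\<forall>w\<in>words k (length u + length v) - ?W \<inter> words k (length u + length v). ?c w * unshuffle_sum (word_pair u v) w = 0"
        using zero by blast
    qed auto
    finally show ?thesis using cc by simp
  qed
  ultimately show ?thesis by (simp add: shuffle_character_def)
qed

end

section \<open>Semi-norms and the Borel sets of the group\<close>

definition semi_term :: "real \<Rightarrow> nat \<Rightarrow> (nat list \<Rightarrow> real) \<Rightarrow> nat \<Rightarrow> real" where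
  "semi_term K k c m = (\<Sum>w\<in>words k m. K ^ m * \<bar>c w\<bar>)"

lemma semi_term_nonneg: "0 \<le> K \<Longrightarrow> 0 \<le> semi_term K k c m"
  by (simp add: semi_term_def sum_nonneg)

lemma exp_gamma_eq:
  assumes "0 \<le> K"
  shows "exp_gamma \<tau> K k h = suminf (\<lambda>m. ennreal (semi_term K k (expansion \<tau> h) m))"
  using assms by (simp add: exp_gamma_def semi_term_def words_def[symmetric] sum_ennreal)

lemma semi_term_mono:
  assumes "0 \<le> K" "K \<le> K'" "k \<le> k'"
  shows "semi_term K k c m \<le> semi_term K' k' c m"
proof -
  have "semi_term K k c m \<le> (\<Sum>w\<in>words k m. K' ^ m * \<bar>c w\<bar>)"
    unfolding semi_term_def using assms by (intro sum_mono mult_right_mono power_mono) auto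
  also have "\<dots> \<le> semi_term K' k' c m"
    unfolding semi_term_def using assms by (intro sum_mono2 finite_words) (auto simp: words_def)
  finally show ?thesis .
qed

lemma exp_gamma_mono:
  assumes "0 \<le> K" "K \<le> K'" "k \<le> k'"
  shows "exp_gamma \<tau> K k h \<le> exp_gamma \<tau> K' k' h"
proof -
  have "0 \<le> K'" using assms by simp
  show ?thesis
    unfolding exp_gamma_eq[OF assms(1)] exp_gamma_eq[OF \<open>0 \<le> K'\<close>]
    by (intro suminf_le ennreal_leI semi_term_mono assms) auto
qed

text \<open>The alphabet \<open>{..<0}\<close>, which the definition of the completion leaves out, is dominated by
  \<open>{..<1}\<close>.\<close>

lemma Hhat_iff_entire: "h \<in> Hhat \<tau> \<longleftrightarrow> entire (expansion \<tau> h)"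
proof
  assume h: "h \<in> Hhat \<tau>"
  show "entire (expansion \<tau> h)"
    unfolding entire_def semi_term_def[symmetric]
  proof (intro allI impI)
    fix k and L :: real assume L: "L > 0"
    have "\<forall>K>0. exp_gamma \<tau> K (Suc k) h < \<infinity>" using h by (simp add: Hhat_def)
    then have "exp_gamma \<tau> L (Suc k) h \<noteq> top" using L by (metis infinity_ennreal_def less_irrefl)
    then have "exp_gamma \<tau> L k h \<noteq> top"
      using exp_gamma_mono[of L L k "Suc k" \<tau> h] L by (auto simp: top_unique)
    then show "summable (semi_term L k (expansion \<tau> h))"
      using L by (intro summable_suminf_not_top) (auto simp: exp_gamma_eq semi_term_nonneg)
  qed
next
  assume e: "entire (expansion \<tau> h)"
  have "exp_gamma \<tau> K k h \<noteq> top" if "K > 0" for K k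
    using e that unfolding exp_gamma_eq[OF less_imp_le[OF that]]
    by (intro ennreal_suminf_neq_top semi_term_nonneg)
       (auto simp: entire_def semi_term_def[symmetric])
  then show "h \<in> Hhat \<tau>" by (auto simp: Hhat_def top.not_eq_extremum)
qed

abbreviation sdiff :: "'d series \<Rightarrow> 'd series \<Rightarrow> 'd series" where
  "sdiff x y \<equiv> (\<lambda>\<sigma>. x \<sigma> - y \<sigma>)"

definition seminorm_ball :: "(nat \<Rightarrow> 'd rtree) \<Rightarrow> 'd series \<Rightarrow> real \<Rightarrow> nat \<Rightarrow> real \<Rightarrow> 'd series set" where
  "seminorm_ball \<tau> x K k \<epsilon> = {y \<in> Hhat \<tau>. exp_gamma \<tau> K k (sdiff y x) < ennreal \<epsilon>}"

lemma openin_seminorm_ball: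
  "x \<in> Hhat \<tau> \<Longrightarrow> K > 0 \<Longrightarrow> k \<ge> 1 \<Longrightarrow> \<epsilon> > 0 \<Longrightarrow> openin (Hhat_topology \<tau>) (seminorm_ball \<tau> x K k \<epsilon>)"
  unfolding Hhat_topology_def seminorm_ball_def by (rule topology_generated_by_Basis) blast

text \<open>A dense set of centres. Lists of pairs make countability evident.\<close>

definition rational_combinations :: "(nat \<Rightarrow> 'd rtree) \<Rightarrow> 'd series set" where
  "rational_combinations \<tau> = range (\<lambda>l :: (nat list \<times> rat) list. \<lambda>\<sigma>. \<Sum>(w, q)\<leftarrow>l. of_rat q * GL_word \<tau> w \<sigma>)"

lemma countable_rational_combinations: "countable (rational_combinations \<tau>)"
  unfolding rational_combinations_def by simp

definition countable_balls :: "(nat \<Rightarrow> 'd rtree) \<Rightarrow> 'd series set set" where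
  "countable_balls \<tau> = (\<lambda>(x, K, k, n). seminorm_ball \<tau> x (real (Suc K)) k (1 / real (Suc n))) `
     (rational_combinations \<tau> \<times> UNIV \<times> UNIV \<times> UNIV)"

lemma countable_countable_balls: "countable (countable_balls \<tau>)"
  unfolding countable_balls_def by (intro countable_image countable_SIGMA countable_rational_combinations) auto

lemma space_G_borel [simp]: "space (G_borel \<tau>) = G \<tau>"
  by (simp add: G_borel_def space_measure_of_conv)

lemma openin_G_subset: "openin (G_topology \<tau>) U \<Longrightarrow> U \<subseteq> G \<tau>"
  by (auto simp: G_topology_def openin_subtopology)

lemma sets_G_borel: "sets (G_borel \<tau>) = sigma_sets (G \<tau>) {U. openin (G_topology \<tau>) U}"
  unfolding G_borel_def by (rule sets_measure_of) (use openin_G_subset in blast)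

context
  fixes \<tau> :: "nat \<Rightarrow> 'd::finite rtree"
  assumes free: "free_generators \<tau>"
begin

lemma exp_gamma_triangle:
  assumes K: "0 \<le> K"
  shows "exp_gamma \<tau> K k (sdiff x z) \<le> exp_gamma \<tau> K k (sdiff x y) + exp_gamma \<tau> K k (sdiff y z)"
proof -
  let ?s = "\<lambda>x y m. ennreal (semi_term K k (expansion \<tau> (sdiff x y)) m)"
  have "semi_term K k (expansion \<tau> (sdiff x z)) m \<le>
      semi_term K k (expansion \<tau> (sdiff x y)) m + semi_term K k (expansion \<tau> (sdiff y z)) m" for m
    unfolding semi_term_def sum.distrib[symmetric] distrib_left[symmetric] expansion_diff[OF free]
    using K by (intro sum_mono mult_left_mono) auto
  then have "?s x z m \<le> ?s x y m + ?s y z m" for m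
    using K by (simp add: ennreal_plus[symmetric] semi_term_nonneg ennreal_leI del: ennreal_plus)
  then have "suminf (?s x z) \<le> suminf (\<lambda>m. ?s x y m + ?s y z m)"
    by (intro suminf_le) auto
  then show ?thesis using K by (simp add: exp_gamma_eq suminf_add[symmetric])
qed

lemma exp_gamma_sym: "exp_gamma \<tau> K k (sdiff x y) = exp_gamma \<tau> K k (sdiff y x)"
  unfolding exp_gamma_def expansion_diff[OF free] by (simp add: abs_minus_commute)

lemma expansion_le_exp_gamma:
  assumes "set w \<subseteq> {..<k}"
  shows "ennreal \<bar>expansion \<tau> x w - expansion \<tau> y w\<bar> \<le> exp_gamma \<tau> 1 k (sdiff x y)"
proof -
  let ?t = "semi_term 1 k (expansion \<tau> (sdiff x y))"
  have "\<bar>expansion \<tau> x w - expansion \<tau> y w\<bar> \<le> ?t (length w)"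
    unfolding semi_term_def expansion_diff[OF free, symmetric]
    using assms member_le_sum[of w "words k (length w)" "\<lambda>w. \<bar>expansion \<tau> (sdiff x y) w\<bar>"]
    by (simp add: words_def finite_words[unfolded words_def])
  then have "ennreal \<bar>expansion \<tau> x w - expansion \<tau> y w\<bar> \<le> ennreal (?t (length w))"
    by (rule ennreal_leI)
  also have "\<dots> = (\<Sum>m\<in>{length w}. ennreal (?t m))" by simp
  also have "\<dots> \<le> exp_gamma \<tau> 1 k (sdiff x y)"
    unfolding exp_gamma_eq[OF zero_le_one] by (rule sum_le_suminf) auto
  finally show ?thesis .
qed

lemma center_in_seminorm_ball: "x \<in> Hhat \<tau> \<Longrightarrow> \<epsilon> > 0 \<Longrightarrow> x \<in> seminorm_ball \<tau> x K k \<epsilon>"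
  unfolding seminorm_ball_def exp_gamma_def expansion_diff[OF free] by simp

lemma seminorm_ball_subset:
  assumes "0 \<le> K" "K \<le> K'" "k \<le> k'" "\<epsilon>' \<le> \<epsilon>"
  shows "seminorm_ball \<tau> x K' k' \<epsilon>' \<subseteq> seminorm_ball \<tau> x K k \<epsilon>"
proof
  fix y assume y: "y \<in> seminorm_ball \<tau> x K' k' \<epsilon>'"
  have "exp_gamma \<tau> K k (sdiff y x) \<le> exp_gamma \<tau> K' k' (sdiff y x)"
    by (rule exp_gamma_mono[OF assms(1-3)])
  also have "\<dots> < ennreal \<epsilon>'" using y by (simp add: seminorm_ball_def)
  also have "\<dots> \<le> ennreal \<epsilon>" by (rule ennreal_leI[OF assms(4)])
  finally show "y \<in> seminorm_ball \<tau> x K k \<epsilon>" using y by (simp add: seminorm_ball_def)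
qed

text \<open>The balls generate the topology as a subbase; since the semi-norms are directed and satisfy the
  triangle inequality, balls around a point form a neighbourhood base of it.\<close>

lemma seminorm_ball_in_open:
  assumes "openin (Hhat_topology \<tau>) T" "y \<in> T"
  shows "y \<in> Hhat \<tau> \<and> (\<exists>K>0. \<exists>k\<ge>1. \<exists>\<epsilon>>0. seminorm_ball \<tau> y K k \<epsilon> \<subseteq> T)"
  using assms unfolding Hhat_topology_def openin_topology_generated_by_iff
proof (induction arbitrary: y)
  case (Int S T)
  from Int.IH(1)[of y] Int.prems obtain K k \<epsilon> where
    1: "y \<in> Hhat \<tau>" "K > 0" "k \<ge> 1" "\<epsilon> > 0" "seminorm_ball \<tau> y K k \<epsilon> \<subseteq> S" by auto
  from Int.IH(2)[of y] Int.prems obtain K' k' \<epsilon>' where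
    2: "K' > 0" "k' \<ge> 1" "\<epsilon>' > 0" "seminorm_ball \<tau> y K' k' \<epsilon>' \<subseteq> T" by auto
  have "seminorm_ball \<tau> y (max K K') (max k k') (min \<epsilon> \<epsilon>') \<subseteq> seminorm_ball \<tau> y K k \<epsilon>"
    "seminorm_ball \<tau> y (max K K') (max k k') (min \<epsilon> \<epsilon>') \<subseteq> seminorm_ball \<tau> y K' k' \<epsilon>'"
    using 1 2 by (intro seminorm_ball_subset; simp)+
  with 1 2 show ?case
    by (intro conjI exI[of _ "max K K'"] exI[of _ "max k k'"] exI[of _ "min \<epsilon> \<epsilon>'"]) auto
next
  case (UN \<K>)
  then obtain S where "S \<in> \<K>" "y \<in> S" by blast
  with UN.IH[of S y] show ?case by (meson Union_upper order_trans)
next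
  case (Basis S)
  then obtain x K k \<epsilon> where S: "S = seminorm_ball \<tau> x K k \<epsilon>" "K > 0" "k \<ge> 1" "\<epsilon> > 0"
    by (auto simp: seminorm_ball_def)
  with Basis have y: "y \<in> Hhat \<tau>" "exp_gamma \<tau> K k (sdiff y x) < ennreal \<epsilon>"
    by (auto simp: seminorm_ball_def)
  then obtain r where r: "0 \<le> r" "exp_gamma \<tau> K k (sdiff y x) = ennreal r" "r < \<epsilon>"
    by (cases "exp_gamma \<tau> K k (sdiff y x)") (auto simp: ennreal_less_iff)
  have "seminorm_ball \<tau> y K k (\<epsilon> - r) \<subseteq> S"
  proof
    fix z assume z: "z \<in> seminorm_ball \<tau> y K k (\<epsilon> - r)"
    have "exp_gamma \<tau> K k (sdiff z x) \<le> exp_gamma \<tau> K k (sdiff z y) + exp_gamma \<tau> K k (sdiff y x)"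
      using S by (intro exp_gamma_triangle) simp
    also have "\<dots> < ennreal (\<epsilon> - r) + ennreal r"
      using z unfolding r(2) add.commute[of _ "ennreal r"] ennreal_add_left_cancel_less
      by (simp add: seminorm_ball_def)
    also have "\<dots> = ennreal \<epsilon>" using r by (simp add: ennreal_plus[symmetric] del: ennreal_plus)
    finally show "z \<in> S" using z by (simp add: S seminorm_ball_def)
  qed
  with y S r show ?case by (intro conjI exI[of _ K] exI[of _ k] exI[of _ "\<epsilon> - r"]) auto
qed simp

text \<open>A semi-norm sees only words over a finite alphabet, and up to a small tail only finitely many of
  these; their coefficients are replaced by nearby rationals.\<close>

lemma rational_combinations_dense:
  assumes y: "y \<in> Hhat \<tau>" and K: "K > 0" and \<epsilon>: "\<epsilon> > 0"
  shows "\<exists>x\<in>rational_combinations \<tau>. exp_gamma \<tau> K k (sdiff y x) < ennreal \<epsilon>"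
proof -
  let ?c = "expansion \<tau> y"
  have sm: "summable (semi_term K k ?c)"
    using y K unfolding Hhat_iff_entire entire_def semi_term_def[abs_def] by blast
  obtain N where N: "suminf (\<lambda>i. semi_term K k ?c (i + N)) < \<epsilon> / 2"
    using suminf_exist_split[OF _ sm, of "\<epsilon> / 2"] \<epsilon>
    by (metis abs_ge_self half_gt_zero order_refl order_le_less_trans real_norm_def)
  define S where "S = (\<Union>m<N. words k m)"
  have finS: "finite S" by (simp add: S_def)
  define t where "t = (\<Sum>m<N. \<Sum>w\<in>words k m. K ^ m)"
  have t: "t \<ge> 0" using K by (auto simp: t_def intro!: sum_nonneg)
  \<comment> \<open>An error of \<open>\<eta>\<close> in each retained coefficient costs at most \<open>t * \<eta> \<le> \<epsilon> / 2\<close>; adding \<open>1\<close> avoids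
    division by zero when \<open>N = 0\<close>.\<close>
  define \<eta> where "\<eta> = \<epsilon> / (2 * (t + 1))"
  have \<eta>: "\<eta> > 0" using \<epsilon> t by (simp add: \<eta>_def)
  have "\<exists>q :: rat. \<bar>?c w - of_rat q\<bar> < \<eta>" for w
  proof -
    obtain r where "r \<in> \<rat>" "?c w < r" "r < ?c w + \<eta>" using Rats_dense_in_real[of "?c w" "?c w + \<eta>"] \<eta> by auto
    then obtain q :: rat where "?c w < of_rat q" "of_rat q < ?c w + \<eta>" by (auto elim!: Rats_cases)
    then show ?thesis by (intro exI[of _ q]) auto
  qed
  then obtain q :: "nat list \<Rightarrow> rat" where q: "\<And>w. \<bar>?c w - of_rat (q w)\<bar> < \<eta>" by metis
  obtain ws where ws: "set ws = S" "distinct ws" using finite_distinct_list[OF finS] by blast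
  define x where "x = (\<lambda>\<sigma>. \<Sum>w\<in>S. of_rat (q w) * GL_word \<tau> w \<sigma>)"
  have "x = (\<lambda>\<sigma>. \<Sum>(w, q)\<leftarrow>map (\<lambda>w. (w, q w)) ws. of_rat q * GL_word \<tau> w \<sigma>)"
    unfolding x_def ws(1)[symmetric] by (simp add: sum_list_distinct_conv_sum_set[OF ws(2), symmetric] comp_def)
  then have x: "x \<in> rational_combinations \<tau>" unfolding rational_combinations_def by blast
  have ex: "expansion \<tau> (sdiff y x) w = (if w \<in> S then ?c w - of_rat (q w) else ?c w)" for w
    unfolding expansion_diff[OF free] x_def expansion_finite[OF free finS] by simp
  let ?s = "semi_term K k (expansion \<tau> (sdiff y x))"
  have tail: "?s (i + N) = semi_term K k ?c (i + N)" for i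
    unfolding semi_term_def ex by (intro sum.cong refl) (auto simp: S_def words_def)
  have head: "?s m \<le> (\<Sum>w\<in>words k m. K ^ m * \<eta>)" if "m < N" for m
    unfolding semi_term_def ex using that K q by (intro sum_mono mult_left_mono) (auto simp: S_def less_imp_le)
  have sms: "summable ?s"
    using sm unfolding summable_iff_shift[of ?s N, symmetric] tail summable_iff_shift[of "semi_term K k ?c" N] .
  have "suminf ?s = suminf (\<lambda>i. ?s (i + N)) + (\<Sum>m<N. ?s m)"
    using suminf_split_initial_segment[OF sms] .
  also have "(\<Sum>m<N. ?s m) \<le> (\<Sum>m<N. \<Sum>w\<in>words k m. K ^ m * \<eta>)"
    by (intro sum_mono head) simp
  also have "\<dots> = t * \<eta>" by (simp only: t_def sum_distrib_right)
  also have "\<dots> \<le> \<epsilon> / 2" using t \<epsilon> by (simp add: \<eta>_def field_simps)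
  finally have "suminf ?s < \<epsilon>" using N by (simp add: tail)
  then have "suminf (\<lambda>m. ennreal (?s m)) < ennreal \<epsilon>"
    using K sms \<epsilon> by (simp add: suminf_ennreal2 semi_term_nonneg ennreal_less_iff suminf_nonneg)
  with x K show ?thesis by (auto simp: exp_gamma_eq)
qed

text \<open>The countably many balls with dense centres, integral parameters and radii \<open>1 / n\<close> form a base.\<close>

lemma countable_ball_in_open:
  assumes "openin (Hhat_topology \<tau>) T" "y \<in> T"
  shows "\<exists>B\<in>countable_balls \<tau>. y \<in> B \<and> B \<subseteq> T"
proof -
  from seminorm_ball_in_open[OF assms] obtain K k \<epsilon> where
    y: "y \<in> Hhat \<tau>" and K: "K > 0" "k \<ge> 1" "\<epsilon> > 0" "seminorm_ball \<tau> y K k \<epsilon> \<subseteq> T" by blast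
  obtain L :: nat where L: "K \<le> real L" using real_arch_simple by blast
  obtain n :: nat where n: "2 / \<epsilon> < real n" using reals_Archimedean2 by blast
  have n': "1 / real (Suc n) + 1 / real (Suc n) \<le> \<epsilon>"
    using n K by (simp add: field_simps)
  obtain x where x: "x \<in> rational_combinations \<tau>"
    "exp_gamma \<tau> (real (Suc L)) k (sdiff y x) < ennreal (1 / real (Suc n))"
    using rational_combinations_dense[OF y, of "real (Suc L)" "1 / real (Suc n)" k] by auto
  let ?B = "seminorm_ball \<tau> x (real (Suc L)) k (1 / real (Suc n))"
  have "?B \<subseteq> seminorm_ball \<tau> y K k \<epsilon>"
  proof
    fix z assume z: "z \<in> ?B"
    have "exp_gamma \<tau> K k (sdiff z y) \<le> exp_gamma \<tau> (real (Suc L)) k (sdiff z y)"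
      using K L by (intro exp_gamma_mono) auto
    also have "\<dots> \<le> exp_gamma \<tau> (real (Suc L)) k (sdiff z x) + exp_gamma \<tau> (real (Suc L)) k (sdiff x y)"
      by (rule exp_gamma_triangle) simp
    also have "\<dots> < ennreal (1 / real (Suc n)) + ennreal (1 / real (Suc n))"
      using z x(2) unfolding seminorm_ball_def by (intro add_strict_mono) (auto simp: exp_gamma_sym[of _ _ x y])
    also have "\<dots> \<le> ennreal \<epsilon>"
      using n' by (simp add: ennreal_plus[symmetric] ennreal_leI del: ennreal_plus)
    finally show "z \<in> seminorm_ball \<tau> y K k \<epsilon>" using z by (simp add: seminorm_ball_def)
  qed
  moreover have "y \<in> ?B" using y x by (simp add: seminorm_ball_def)
  moreover have "?B \<in> countable_balls \<tau>"
    unfolding countable_balls_def using x(1) by (intro image_eqI[where x="(x, L, k, n)"]) auto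
  ultimately show ?thesis using K(4) by blast
qed

text \<open>Coordinates are continuous, being dominated by a semi-norm with \<open>K = 1\<close>.\<close>

lemma measurable_expansion:
  "(\<lambda>h. expansion \<tau> h w) \<in> borel_measurable (G_borel \<tau>)"
  unfolding borel_measurable_iff_greater
proof
  fix a :: real
  let ?S = "{h \<in> Hhat \<tau>. a < expansion \<tau> h w}"
  obtain k where k: "set w \<subseteq> {..<Suc k}"
    using finite_nat_iff_bounded_le[of "set w"] by (auto simp: lessThan_Suc_atMost)
  have "openin (Hhat_topology \<tau>) ?S"
  proof (subst openin_subopen, intro ballI)
    fix x assume x: "x \<in> ?S"
    let ?B = "seminorm_ball \<tau> x 1 (Suc k) (expansion \<tau> x w - a)"
    have "?B \<subseteq> ?S"
    proof
      fix y assume y: "y \<in> ?B"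
      have "ennreal \<bar>expansion \<tau> y w - expansion \<tau> x w\<bar> < ennreal (expansion \<tau> x w - a)"
        using expansion_le_exp_gamma[OF k, of y x] y by (auto simp: seminorm_ball_def intro: le_less_trans)
      then have "\<bar>expansion \<tau> y w - expansion \<tau> x w\<bar> < expansion \<tau> x w - a" by (simp add: ennreal_less_iff)
      then show "y \<in> ?S" using y by (auto simp: seminorm_ball_def)
    qed
    with x show "\<exists>T. openin (Hhat_topology \<tau>) T \<and> x \<in> T \<and> T \<subseteq> ?S"
      by (intro exI[of _ ?B] conjI openin_seminorm_ball center_in_seminorm_ball) auto
  qed
  then have "openin (G_topology \<tau>) (?S \<inter> G \<tau>)"
    unfolding G_topology_def by (rule openin_subtopology_Int)
  moreover have "?S \<inter> G \<tau> = {h \<in> space (G_borel \<tau>). a < expansion \<tau> h w}"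
    by (auto simp: G_def)
  ultimately show "{h \<in> space (G_borel \<tau>). a < expansion \<tau> h w} \<in> sets (G_borel \<tau>)"
    by (auto simp: sets_G_borel)
qed

text \<open>Open sets are countable unions of balls, and each ball is given by a countable sum of functions
  of the coordinates. Without second countability arbitrary unions would be out of reach.\<close>

lemma open_in_coordinate_sigma_algebra:
  assumes S: "space S = G \<tau>" "\<And>w. (\<lambda>h. expansion \<tau> h w) \<in> borel_measurable S"
    and U: "openin (G_topology \<tau>) U"
  shows "U \<in> sets S"
proof -
  from U obtain T where T: "openin (Hhat_topology \<tau>) T" "U = T \<inter> G \<tau>"
    by (auto simp: G_topology_def openin_subtopology)
  have "U = (\<Union>B\<in>{B \<in> countable_balls \<tau>. B \<subseteq> T}. B \<inter> G \<tau>)"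
    using countable_ball_in_open[OF T(1)] by (auto simp: T(2))
  moreover have "B \<inter> G \<tau> \<in> sets S" if B_in: "B \<in> countable_balls \<tau>" for B
  proof -
    note [measurable] = S(2)
    obtain x K k n where B: "B = seminorm_ball \<tau> x (real (Suc K)) k (1 / real (Suc n))"
      using B_in unfolding countable_balls_def by (elim imageE) (simp add: split_beta)
    have "(\<lambda>h. exp_gamma \<tau> (real (Suc K)) k (sdiff h x)) \<in> borel_measurable S"
      unfolding exp_gamma_def expansion_diff[OF free] by measurable
    then have "{h \<in> space S. exp_gamma \<tau> (real (Suc K)) k (sdiff h x) < ennreal (1 / real (Suc n))} \<in> sets S"
      by measurable
    moreover have "B \<inter> G \<tau> = {h \<in> space S. exp_gamma \<tau> (real (Suc K)) k (sdiff h x) < ennreal (1 / real (Suc n))}"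
      by (auto simp: B seminorm_ball_def S(1) G_def)
    ultimately show ?thesis by simp
  qed
  moreover have "countable {B \<in> countable_balls \<tau>. B \<subseteq> T}"
    using countable_countable_balls by (rule countable_subset[rotated]) blast
  ultimately show ?thesis by (simp only:) (rule sets.countable_UN', auto)
qed

end

section \<open>Expectations of functionals\<close>

text \<open>The square of a coordinate is a sum of coordinates of words of twice the length. Hence the second
  moments of the coordinates are controlled by the expected coordinates, which decay faster than
  any exponential. By the inequality of arithmetic and geometric means so do the first absolute
  moments, even summed over the exponentially many words of a given length.\<close>

lemma entire_expected_abs:
  fixes c :: "'x \<Rightarrow> nat list \<Rightarrow> real"
  assumes "prob_space \<mu>"
    and ch: "\<And>x. x \<in> space \<mu> \<Longrightarrow> shuffle_character (c x)"
    and int: "\<And>w. integrable \<mu> (\<lambda>x. c x w)"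
    and ent: "entire (\<lambda>w. \<integral>x. c x w \<partial>\<mu>)"
  shows "entire (\<lambda>w. \<integral>x. \<bar>c x w\<bar> \<partial>\<mu>)"
  unfolding entire_def
proof (intro allI impI)
  fix k and L :: real assume L: "L > 0"
  interpret prob_space \<mu> by fact
  define e where "e w = (\<integral>x. c x w \<partial>\<mu>)" for w
  define \<kappa> where "\<kappa> = real k + 1"
  have \<kappa>: "\<kappa> > 0" "real k \<le> \<kappa>" by (auto simp: \<kappa>_def)
  \<comment> \<open>\<open>K^(2m)\<close> is the product of the factor \<open>(2\<kappa>)^m L^(2m)\<close> that the second moments acquire in
    the inequality of arithmetic and geometric means below, and of the number \<open>4^m\<close> of splittings of
    a word of length \<open>2m\<close>.\<close>
  define K where "K = sqrt (8 * \<kappa> * L\<^sup>2)"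
  have K: "K > 0" "K\<^sup>2 = 8 * \<kappa> * L\<^sup>2" using L \<kappa> by (auto simp: K_def)
  have sq: "c x u ^ 2 = (\<Sum>w\<in>words k (2 * m). c x w * unshuffle_sum (word_pair u u) w)"
    if "u \<in> words k m" "x \<in> space \<mu>" for x u m
    using ch[OF that(2)] that(1) by (auto simp: shuffle_character_def words_def power2_eq_square mult_2)
  have sq_int: "integrable \<mu> (\<lambda>x. c x u ^ 2)"
    and sq_eq: "(\<integral>x. c x u ^ 2 \<partial>\<mu>) = (\<Sum>w\<in>words k (2 * m). e w * unshuffle_sum (word_pair u u) w)"
    if u: "u \<in> words k m" for u m
  proof -
    have "integrable \<mu> (\<lambda>x. \<Sum>w\<in>words k (2 * m). c x w * unshuffle_sum (word_pair u u) w)"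
      using int by auto
    then show "integrable \<mu> (\<lambda>x. c x u ^ 2)"
      by (subst Bochner_Integration.integrable_cong[OF refl sq[OF u]])
    have "(\<integral>x. c x u ^ 2 \<partial>\<mu>) = (\<integral>x. (\<Sum>w\<in>words k (2 * m). c x w * unshuffle_sum (word_pair u u) w) \<partial>\<mu>)"
      by (rule Bochner_Integration.integral_cong[OF refl sq[OF u]])
    then show "(\<integral>x. c x u ^ 2 \<partial>\<mu>) = (\<Sum>w\<in>words k (2 * m). e w * unshuffle_sum (word_pair u u) w)"
      using int by (simp add: e_def)
  qed
  have sum_sq: "(\<Sum>u\<in>words k m. \<integral>x. c x u ^ 2 \<partial>\<mu>) \<le> 4 ^ m * (\<Sum>w\<in>words k (2 * m). \<bar>e w\<bar>)" for m
  proof -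
    have "(\<Sum>u\<in>words k m. \<integral>x. c x u ^ 2 \<partial>\<mu>) =
        (\<Sum>w\<in>words k (2 * m). e w * unshuffle_sum (\<lambda>s t. \<Sum>u\<in>words k m. word_pair u u s t) w)"
      by (simp add: sq_eq unshuffle_sum_sum sum_distrib_left sum.swap[of _ "words k m"])
    also have "\<dots> \<le> (\<Sum>w\<in>words k (2 * m). \<bar>e w\<bar> * 4 ^ m)"
    proof (rule sum_mono)
      fix w assume w: "w \<in> words k (2 * m)"
      let ?F = "\<lambda>s t. \<Sum>u\<in>words k m. word_pair u u s t"
      have F: "0 \<le> ?F s t \<and> ?F s t \<le> 1" for s t
      proof -
        have "?F s t = (\<Sum>u\<in>words k m. if u = s then of_bool (s = t) else 0)"
          by (intro sum.cong) (auto simp: word_pair_def)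
        then show ?thesis by simp
      qed
      have "\<bar>unshuffle_sum ?F w\<bar> \<le> unshuffle_sum (\<lambda>s t. \<bar>?F s t\<bar>) w" by (rule unshuffle_sum_abs)
      also have "\<dots> \<le> unshuffle_sum (\<lambda>s t. 1 ^ length s * 1 ^ length t) w"
      proof (rule unshuffle_sum_mono)
        fix s t show "\<bar>?F s t\<bar> \<le> 1 ^ length s * 1 ^ length t"
          using F[of s t] by (simp only: abs_of_nonneg power_one mult_1)
      qed
      also have "\<dots> = 4 ^ m" using w by (simp only: unshuffle_sum_power) (simp add: words_def power_mult)
      finally have "\<bar>e w\<bar> * \<bar>unshuffle_sum ?F w\<bar> \<le> \<bar>e w\<bar> * 4 ^ m" by (intro mult_left_mono) auto
      then show "e w * unshuffle_sum ?F w \<le> \<bar>e w\<bar> * 4 ^ m"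
        using abs_ge_self[of "e w * unshuffle_sum ?F w"] unfolding abs_mult by (rule order_trans[rotated])
    qed
    also have "\<dots> = 4 ^ m * (\<Sum>w\<in>words k (2 * m). \<bar>e w\<bar>)"
      unfolding sum_distrib_right[symmetric] by (rule mult.commute)
    finally show ?thesis .
  qed
  have amgm: "L ^ m * \<bar>y\<bar> \<le> (1 / (2 * \<kappa>) ^ m + (2 * \<kappa> * L\<^sup>2) ^ m * y\<^sup>2) / 2" for y :: real and m
  proof -
    \<comment> \<open>The weight that makes the constant terms summable over the \<open>k^m\<close> words of length \<open>m\<close>.\<close>
    define A where "A = (2 * \<kappa>) ^ m"
    have A: "A > 0" using \<kappa> by (simp add: A_def)
    have "0 \<le> (1 - A * L ^ m * \<bar>y\<bar>)\<^sup>2" by simp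
    also have "\<dots> = 1 - 2 * A * (L ^ m * \<bar>y\<bar>) + A\<^sup>2 * (L ^ m)\<^sup>2 * y\<^sup>2"
      by (simp add: power2_eq_square algebra_simps)
    finally have "2 * A * (L ^ m * \<bar>y\<bar>) \<le> 1 + A\<^sup>2 * (L ^ m)\<^sup>2 * y\<^sup>2" by simp
    then have "L ^ m * \<bar>y\<bar> \<le> (1 / A + A * (L ^ m)\<^sup>2 * y\<^sup>2) / 2"
      using A by (simp add: field_simps power2_eq_square)
    moreover have "A * (L ^ m)\<^sup>2 = (2 * \<kappa> * L\<^sup>2) ^ m"
      by (simp add: A_def power_mult_distrib power_mult[symmetric] mult.commute)
    ultimately show ?thesis by (simp add: A_def)
  qed
  have bound: "(\<Sum>u\<in>words k m. L ^ m * (\<integral>x. \<bar>c x u\<bar> \<partial>\<mu>)) \<le>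
      ((1 / 2) ^ m + (\<Sum>w\<in>words k (2 * m). K ^ (2 * m) * \<bar>e w\<bar>)) / 2" for m
  proof -
    have "(\<Sum>u\<in>words k m. L ^ m * (\<integral>x. \<bar>c x u\<bar> \<partial>\<mu>)) \<le>
       (\<Sum>u\<in>words k m. (1 / (2 * \<kappa>) ^ m + (2 * \<kappa> * L\<^sup>2) ^ m * (\<integral>x. c x u ^ 2 \<partial>\<mu>)) / 2)"
    proof (rule sum_mono)
      fix u assume u: "u \<in> words k m"
      have "L ^ m * (\<integral>x. \<bar>c x u\<bar> \<partial>\<mu>) = (\<integral>x. L ^ m * \<bar>c x u\<bar> \<partial>\<mu>)" by simp
      also have "\<dots> \<le> (\<integral>x. (1 / (2 * \<kappa>) ^ m + (2 * \<kappa> * L\<^sup>2) ^ m * (c x u)\<^sup>2) / 2 \<partial>\<mu>)"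
        using int sq_int[OF u] amgm by (intro integral_mono) auto
      also have "\<dots> = (1 / (2 * \<kappa>) ^ m + (2 * \<kappa> * L\<^sup>2) ^ m * (\<integral>x. c x u ^ 2 \<partial>\<mu>)) / 2"
        using sq_int[OF u] by (simp add: prob_space)
      finally show "L ^ m * (\<integral>x. \<bar>c x u\<bar> \<partial>\<mu>) \<le> (1 / (2 * \<kappa>) ^ m + (2 * \<kappa> * L\<^sup>2) ^ m * (\<integral>x. c x u ^ 2 \<partial>\<mu>)) / 2" .
    qed
    also have "\<dots> = (real k ^ m / (2 * \<kappa>) ^ m + (2 * \<kappa> * L\<^sup>2) ^ m * (\<Sum>u\<in>words k m. \<integral>x. c x u ^ 2 \<partial>\<mu>)) / 2"
      by (simp add: sum_divide_distrib[symmetric] sum.distrib sum_distrib_left[symmetric] card_words)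
    also have "\<dots> \<le> ((1 / 2) ^ m + (2 * \<kappa> * L\<^sup>2) ^ m * (4 ^ m * (\<Sum>w\<in>words k (2 * m). \<bar>e w\<bar>))) / 2"
    proof (intro divide_right_mono add_mono mult_left_mono sum_sq)
      have "real k ^ m / (2 * \<kappa>) ^ m = (real k / (2 * \<kappa>)) ^ m" by (simp add: power_divide)
      also have "\<dots> \<le> (1 / 2) ^ m" using \<kappa> by (intro power_mono) (auto simp: field_simps)
      finally show "real k ^ m / (2 * \<kappa>) ^ m \<le> (1 / 2) ^ m" .
    qed (use \<kappa> in auto)
    also have "(2 * \<kappa> * L\<^sup>2) ^ m * (4 ^ m * (\<Sum>w\<in>words k (2 * m). \<bar>e w\<bar>)) = (\<Sum>w\<in>words k (2 * m). K ^ (2 * m) * \<bar>e w\<bar>)"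
      unfolding power_mult K(2) by (simp add: sum_distrib_left power_mult_distrib[symmetric] mult.assoc[symmetric] mult.commute[of _ 4])
    finally show ?thesis .
  qed
  have "summable (\<lambda>m. \<Sum>w\<in>words k m. K ^ m * \<bar>e w\<bar>)"
    using ent K(1) by (simp add: entire_def e_def)
  then have "summable ((\<lambda>m. \<Sum>w\<in>words k m. K ^ m * \<bar>e w\<bar>) \<circ> (\<lambda>m. 2 * m))"
    by (rule summable_reindex) (use K(1) in \<open>auto simp: inj_on_def intro!: sum_nonneg\<close>)
  then have "summable (\<lambda>m. ((1 / 2) ^ m + (\<Sum>w\<in>words k (2 * m). K ^ (2 * m) * \<bar>e w\<bar>)) / 2)"
    by (intro summable_divide summable_add summable_geometric) (auto simp: comp_def)
  then show "summable (\<lambda>m. \<Sum>w\<in>words k m. L ^ m * \<bar>\<integral>x. \<bar>c x w\<bar> \<partial>\<mu>\<bar>)"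
  proof (rule summable_comparison_test'[where N=0])
    fix m
    have "0 \<le> (\<Sum>u\<in>words k m. L ^ m * (\<integral>x. \<bar>c x u\<bar> \<partial>\<mu>))"
      using L by (intro sum_nonneg mult_nonneg_nonneg integral_nonneg) auto
    then show "norm (\<Sum>w\<in>words k m. L ^ m * \<bar>\<integral>x. \<bar>c x w\<bar> \<partial>\<mu>\<bar>) \<le>
        ((1 / 2) ^ m + (\<Sum>w\<in>words k (2 * m). K ^ (2 * m) * \<bar>e w\<bar>)) / 2"
      using bound[of m] by simp
  qed
qed

text \<open>Absolute summability of the first moments allows exchange of expectation and series.\<close>

lemma expected_pairing:
  fixes c :: "'x \<Rightarrow> nat list \<Rightarrow> real"
  assumes "prob_space \<mu>"
    and ch: "\<And>x. x \<in> space \<mu> \<Longrightarrow> shuffle_character (c x)" "\<And>x. x \<in> space \<mu> \<Longrightarrow> entire (c x)"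
    and int: "\<And>w. integrable \<mu> (\<lambda>x. c x w)"
    and ent: "entire (\<lambda>w. \<integral>x. c x w \<partial>\<mu>)"
    and a: "exp_bounded a"
  shows "(\<integral>x. pairing k a (c x) \<partial>\<mu>) = pairing k a (\<lambda>w. \<integral>x. c x w \<partial>\<mu>)"
proof -
  from a obtain C L where CL: "C \<ge> 0" "L > 0" "\<And>w. \<bar>a w\<bar> \<le> C * L ^ length w"
    by (auto simp: exp_bounded_def)
  have pint: "integrable \<mu> (\<lambda>x. pair_deg k a (c x) m)" for m
    unfolding pair_deg_def using int by auto
  have "(\<integral>x. pairing k a (c x) \<partial>\<mu>) = suminf (\<lambda>m. \<integral>x. pair_deg k a (c x) m \<partial>\<mu>)"
    unfolding pairing_def
  proof (rule integral_suminf[OF pint])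
    show "AE x in \<mu>. summable (\<lambda>m. norm (pair_deg k a (c x) m))"
      by (rule AE_I2) (use summable_pair_deg[OF a] ch in auto)
    have "summable (\<lambda>m. C * (\<Sum>w\<in>words k m. L ^ m * \<bar>\<integral>x. \<bar>c x w\<bar> \<partial>\<mu>\<bar>))"
      using entire_expected_abs[OF assms(1) ch(1) int ent] CL(2) by (intro summable_mult) (auto simp: entire_def)
    then show "summable (\<lambda>m. \<integral>x. norm (pair_deg k a (c x) m) \<partial>\<mu>)"
    proof (rule summable_comparison_test'[where N=0])
      fix m
      have "(\<integral>x. norm (pair_deg k a (c x) m) \<partial>\<mu>) \<le> (\<integral>x. C * (\<Sum>w\<in>words k m. L ^ m * \<bar>c x w\<bar>) \<partial>\<mu>)"
        using pint int abs_pair_deg_le[OF CL(3)] by (intro integral_mono) auto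
      also have "\<dots> = C * (\<Sum>w\<in>words k m. L ^ m * \<bar>\<integral>x. \<bar>c x w\<bar> \<partial>\<mu>\<bar>)"
        using int by simp
      finally show "norm (\<integral>x. norm (pair_deg k a (c x) m) \<partial>\<mu>) \<le> C * (\<Sum>w\<in>words k m. L ^ m * \<bar>\<integral>x. \<bar>c x w\<bar> \<partial>\<mu>\<bar>)"
        by simp
    qed
  qed
  also have "(\<lambda>m. \<integral>x. pair_deg k a (c x) m \<partial>\<mu>) = pair_deg k a (\<lambda>w. \<integral>x. c x w \<partial>\<mu>)"
    unfolding pair_deg_def using int by auto
  finally show ?thesis by (simp add: pairing_def)
qed

section \<open>Measures determined by a multiplicative system\<close>

text \<open>One more indicator \<open>1{f > a}\<close> can be inserted into the family of equal integrals. Powers of \<open>f\<close> are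
  absorbed into \<open>g\<close>, which gives polynomials of \<open>f\<close>; the Weierstrass theorem on the bounded range
  of \<open>f\<close> gives continuous functions of \<open>f\<close>, among them ramps that converge to the indicator.\<close>

lemma multiplicative_system_step:
  fixes \<mu> \<nu> :: "'x measure" and A :: "('x \<Rightarrow> real) set"
  assumes "prob_space \<mu>" "prob_space \<nu>" and sets: "sets \<mu> = sets \<nu>"
    and meas: "\<And>f. f \<in> A \<Longrightarrow> f \<in> borel_measurable \<mu>"
    and mult: "\<And>f g. f \<in> A \<Longrightarrow> g \<in> A \<Longrightarrow> (\<lambda>x. f x * g x) \<in> A"
    and bdd: "\<And>f. f \<in> A \<Longrightarrow> \<exists>B. \<forall>x\<in>space \<mu>. \<bar>f x\<bar> \<le> B"
    and h: "h \<in> borel_measurable \<mu>" "\<And>x. 0 \<le> h x" "\<And>x. h x \<le> 1"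
    and eq: "\<And>g. g \<in> A \<Longrightarrow> (\<integral>x. h x * g x \<partial>\<mu>) = (\<integral>x. h x * g x \<partial>\<nu>)"
    and f: "f \<in> A" and g: "g \<in> A"
  shows "(\<integral>x. h x * indicator {y. a < f y} x * g x \<partial>\<mu>) =
         (\<integral>x. h x * indicator {y. a < f y} x * g x \<partial>\<nu>)"
proof -
  interpret \<mu>: prob_space \<mu> by fact
  interpret \<nu>: prob_space \<nu> by fact
  have sp: "space \<nu> = space \<mu>" using sets sets_eq_imp_space_eq by blast
  have measeq: "borel_measurable \<nu> = (borel_measurable \<mu> :: ('x \<Rightarrow> real) set)"
    using sets by (simp cong: measurable_cong_sets)
  obtain Bf where Bf: "\<And>x. x \<in> space \<mu> \<Longrightarrow> \<bar>f x\<bar> \<le> Bf" using bdd[OF f] by blast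
  obtain Bg where Bg: "\<And>x. x \<in> space \<mu> \<Longrightarrow> \<bar>g x\<bar> \<le> Bg" using bdd[OF g] by blast
  have fx: "f x \<in> {-Bf..Bf}" if "x \<in> space \<mu>" for x
    using Bf[OF that] by (simp add: abs_le_iff minus_le_iff)
  have Bg0: "0 \<le> Bg"
    using Bg \<mu>.not_empty by (metis abs_ge_zero all_not_in_conv order_trans)
  have [measurable]: "f \<in> borel_measurable \<mu>" "g \<in> borel_measurable \<mu>" "h \<in> borel_measurable \<mu>"
    using meas f g h by auto
  have pow: "(\<lambda>x. f x ^ n * g x) \<in> A" for n
  proof (induction n)
    case (Suc n)
    from mult[OF f Suc] show ?case by (simp add: mult.assoc)
  qed (use g in simp)
  have intble: "integrable \<mu> q \<and> integrable \<nu> q"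
    if "q \<in> borel_measurable \<mu>" "\<And>x. x \<in> space \<mu> \<Longrightarrow> \<bar>q x\<bar> \<le> C" for q :: "'x \<Rightarrow> real" and C
    using that by (intro conjI \<mu>.integrable_const_bound[where B=C] \<nu>.integrable_const_bound[where B=C])
      (auto simp: measeq sp)
  have poly: "(\<integral>x. h x * (\<Sum>i\<le>n. c i * f x ^ i) * g x \<partial>\<mu>) = (\<integral>x. h x * (\<Sum>i\<le>n. c i * f x ^ i) * g x \<partial>\<nu>)"
    for c :: "nat \<Rightarrow> real" and n
  proof -
    have i: "integrable \<mu> (\<lambda>x. h x * (f x ^ i * g x)) \<and> integrable \<nu> (\<lambda>x. h x * (f x ^ i * g x))" for i
    proof -
      obtain B where B: "\<And>x. x \<in> space \<mu> \<Longrightarrow> \<bar>f x ^ i * g x\<bar> \<le> B" using bdd[OF pow[of i]] by blast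
      show ?thesis
      proof (rule intble[of _ B])
        fix x assume x: "x \<in> space \<mu>"
        have "\<bar>h x\<bar> * \<bar>f x ^ i * g x\<bar> \<le> 1 * B" by (intro mult_mono B x) (use h in auto)
        then show "\<bar>h x * (f x ^ i * g x)\<bar> \<le> B" by (simp add: abs_mult)
      qed measurable
    qed
    have e: "h x * (\<Sum>i\<le>n. c i * f x ^ i) * g x = (\<Sum>i\<le>n. c i * (h x * (f x ^ i * g x)))" for x
      by (simp add: sum_distrib_left sum_distrib_right mult_ac)
    show ?thesis unfolding e using i by (simp add: eq[OF pow])
  qed
  have cont: "(\<integral>x. h x * \<phi> (f x) * g x \<partial>\<mu>) = (\<integral>x. h x * \<phi> (f x) * g x \<partial>\<nu>)"
    if \<phi>: "continuous_on UNIV \<phi>" for \<phi> :: "real \<Rightarrow> real"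
  proof -
    let ?d = "\<bar>(\<integral>x. h x * \<phi> (f x) * g x \<partial>\<mu>) - (\<integral>x. h x * \<phi> (f x) * g x \<partial>\<nu>)\<bar>"
    have \<phi>m [measurable]: "\<phi> \<in> borel_measurable borel" using \<phi> by (rule borel_measurable_continuous_onI)
    have "?d \<le> 2 * (e * Bg)" if e: "e > 0" for e
    proof -
      obtain p where p: "real_polynomial_function p" "\<And>x. x \<in> {-Bf..Bf} \<Longrightarrow> \<bar>\<phi> x - p x\<bar> < e"
        using Stone_Weierstrass_real_polynomial_function[of "{-Bf..Bf}" \<phi> e] e \<phi> continuous_on_subset
        by (metis compact_Icc subset_UNIV)
      from p(1) obtain c n where pc: "p = (\<lambda>x. \<Sum>i\<le>n. c i * x ^ i)"
        by (auto simp: real_polynomial_function_iff_sum)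
      have pm [measurable]: "p \<in> borel_measurable borel" unfolding pc by measurable
      have bnd: "\<bar>h x * \<phi> (f x) * g x - h x * p (f x) * g x\<bar> \<le> e * Bg" if x: "x \<in> space \<mu>" for x
      proof -
        have "\<bar>h x\<bar> * \<bar>\<phi> (f x) - p (f x)\<bar> * \<bar>g x\<bar> \<le> 1 * e * Bg"
          using h(2,3)[of x] p(2)[OF fx[OF x]] e by (intro mult_mono Bg x) auto
        then show ?thesis by (simp add: abs_mult[symmetric] algebra_simps)
      qed
      obtain C where C: "\<And>y. y \<in> {-Bf..Bf} \<Longrightarrow> \<bar>\<phi> y\<bar> \<le> C"
      proof -
        have "compact (\<phi> ` {-Bf..Bf})"
          by (rule compact_continuous_image) (use \<phi> continuous_on_subset in auto)
        then have "bounded (\<phi> ` {-Bf..Bf})" by (rule compact_imp_bounded)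
        then obtain C where "\<forall>y\<in>\<phi> ` {-Bf..Bf}. norm y \<le> C" unfolding bounded_iff by blast
        then show ?thesis by (intro that[of C]) auto
      qed
      have i1: "integrable \<mu> (\<lambda>x. h x * \<phi> (f x) * g x) \<and> integrable \<nu> (\<lambda>x. h x * \<phi> (f x) * g x)"
      proof (rule intble[of _ "1 * C * Bg"])
        fix x assume x: "x \<in> space \<mu>"
        have "\<bar>h x\<bar> * \<bar>\<phi> (f x)\<bar> * \<bar>g x\<bar> \<le> 1 * C * Bg"
          using h(2,3)[of x] C[OF fx[OF x]] abs_ge_zero[of "\<phi> (f x)"]
          by (intro mult_mono Bg x) (auto intro: order_trans)
        then show "\<bar>h x * \<phi> (f x) * g x\<bar> \<le> 1 * C * Bg" by (simp add: abs_mult)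
      qed measurable
      have i2: "integrable \<mu> (\<lambda>x. h x * \<phi> (f x) * g x - h x * p (f x) * g x) \<and>
                integrable \<nu> (\<lambda>x. h x * \<phi> (f x) * g x - h x * p (f x) * g x)"
        by (rule intble[of _ "e * Bg"]) (use bnd in auto)
      have i3: "integrable \<mu> (\<lambda>x. h x * p (f x) * g x)" "integrable \<nu> (\<lambda>x. h x * p (f x) * g x)"
        using Bochner_Integration.integrable_diff[of \<mu> "\<lambda>x. h x * \<phi> (f x) * g x" "\<lambda>x. h x * \<phi> (f x) * g x - h x * p (f x) * g x"]
          Bochner_Integration.integrable_diff[of \<nu> "\<lambda>x. h x * \<phi> (f x) * g x" "\<lambda>x. h x * \<phi> (f x) * g x - h x * p (f x) * g x"]
          i1 i2 by simp_all
      have d: "\<bar>(\<integral>x. h x * \<phi> (f x) * g x \<partial>\<mu>) - (\<integral>x. h x * p (f x) * g x \<partial>\<mu>)\<bar> \<le> e * Bg"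
        "\<bar>(\<integral>x. h x * \<phi> (f x) * g x \<partial>\<nu>) - (\<integral>x. h x * p (f x) * g x \<partial>\<nu>)\<bar> \<le> e * Bg"
      proof -
        have "\<bar>\<integral>x. h x * \<phi> (f x) * g x - h x * p (f x) * g x \<partial>\<mu>\<bar> \<le> (\<integral>x. e * Bg \<partial>\<mu>)"
          using i2 bnd by (intro order_trans[OF integral_abs_bound] integral_mono) auto
        then show "\<bar>(\<integral>x. h x * \<phi> (f x) * g x \<partial>\<mu>) - (\<integral>x. h x * p (f x) * g x \<partial>\<mu>)\<bar> \<le> e * Bg"
          using i1 i3 by (simp add: \<mu>.prob_space)
        have "\<bar>\<integral>x. h x * \<phi> (f x) * g x - h x * p (f x) * g x \<partial>\<nu>\<bar> \<le> (\<integral>x. e * Bg \<partial>\<nu>)"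
          using i2 bnd sp by (intro order_trans[OF integral_abs_bound] integral_mono) auto
        then show "\<bar>(\<integral>x. h x * \<phi> (f x) * g x \<partial>\<nu>) - (\<integral>x. h x * p (f x) * g x \<partial>\<nu>)\<bar> \<le> e * Bg"
          using i1 i3 by (simp add: \<nu>.prob_space)
      qed
      moreover have "(\<integral>x. h x * p (f x) * g x \<partial>\<mu>) = (\<integral>x. h x * p (f x) * g x \<partial>\<nu>)"
        unfolding pc by (rule poly)
      ultimately show ?thesis by linarith
    qed
    then have bnd: "?d \<le> 2 * (e * Bg)" if "e > 0" for e using that by blast
    have "?d \<le> 0 + e" if "e > 0" for e
    proof -
      have "?d \<le> 2 * (e / (2 * (Bg + 1)) * Bg)"
        using that Bg0 by (intro bnd) simp
      also have "\<dots> = e * (Bg / (Bg + 1))" using Bg0 by (simp add: field_simps)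
      also have "\<dots> \<le> e * 1" using that Bg0 by (intro mult_left_mono) auto
      finally show ?thesis by simp
    qed
    then have "?d \<le> 0" by (rule field_le_epsilon)
    then show ?thesis by simp
  qed
  \<comment> \<open>Piecewise linear ramps that increase to the indicator of \<open>{y. a < y}\<close>.\<close>
  define \<phi> where "\<phi> n y = min 1 (max 0 (real n * (y - a)))" for n :: nat and y
  have \<phi>c: "continuous_on UNIV (\<phi> n)" for n unfolding \<phi>_def by (intro continuous_intros)
  have [measurable]: "\<phi> n \<in> borel_measurable borel" for n using \<phi>c by (rule borel_measurable_continuous_onI)
  have \<phi>lim: "(\<lambda>n. \<phi> n y) \<longlonglongrightarrow> indicator {y. a < y} y" for y
  proof (cases "a < y")
    case True
    obtain N where N: "1 / (y - a) < real N" using reals_Archimedean2 by blast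
    have "1 \<le> real n * (y - a)" if "n \<ge> N" for n
    proof -
      have "1 \<le> real N * (y - a)" using True N by (simp add: field_simps)
      also have "\<dots> \<le> real n * (y - a)" using True that by (intro mult_right_mono) auto
      finally show ?thesis .
    qed
    then have "eventually (\<lambda>n. \<phi> n y = 1) sequentially"
      unfolding eventually_sequentially \<phi>_def by (intro exI[of _ N]) (smt (verit))
    then show ?thesis using True by (simp add: tendsto_eventually)
  next
    case False
    then have "\<phi> n y = 0" for n unfolding \<phi>_def by (simp add: mult_nonneg_nonpos)
    then show ?thesis using False by simp
  qed
  have lim: "(\<lambda>n. \<integral>x. h x * \<phi> n (f x) * g x \<partial>\<kappa>) \<longlonglongrightarrow> (\<integral>x. h x * indicator {y. a < f y} x * g x \<partial>\<kappa>)"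
    if \<kappa>: "prob_space \<kappa>" "sets \<kappa> = sets \<mu>" for \<kappa>
  proof -
    interpret \<kappa>: prob_space \<kappa> by fact
    have [measurable_cong]: "sets \<kappa> = sets \<mu>" by fact
    have spl: "space \<kappa> = space \<mu>" using \<kappa>(2) sets_eq_imp_space_eq by blast
    show ?thesis
    proof (rule integral_dominated_convergence[where w="\<lambda>_. Bg"])
      show "AE x in \<kappa>. (\<lambda>n. h x * \<phi> n (f x) * g x) \<longlonglongrightarrow> h x * indicator {y. a < f y} x * g x"
      proof (rule AE_I2)
        fix x
        show "(\<lambda>n. h x * \<phi> n (f x) * g x) \<longlonglongrightarrow> h x * indicator {y. a < f y} x * g x"
          using \<phi>lim[of "f x"] by (intro tendsto_intros) (simp add: indicator_def)
      qed
      show "AE x in \<kappa>. norm (h x * \<phi> n (f x) * g x) \<le> Bg" for n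
      proof (rule AE_I2)
        fix x assume "x \<in> space \<kappa>"
        then have "\<bar>h x\<bar> * \<bar>\<phi> n (f x)\<bar> * \<bar>g x\<bar> \<le> 1 * 1 * Bg"
          using h(2,3)[of x] by (intro mult_mono Bg) (auto simp: spl \<phi>_def)
        then show "norm (h x * \<phi> n (f x) * g x) \<le> Bg" by (simp add: abs_mult)
      qed
    qed (auto simp: integrable_const)
  qed
  have "(\<lambda>n. \<integral>x. h x * \<phi> n (f x) * g x \<partial>\<mu>) \<longlonglongrightarrow> (\<integral>x. h x * indicator {y. a < f y} x * g x \<partial>\<nu>)"
    unfolding cont[OF \<phi>c] by (rule lim) (use assms in auto)
  with lim[of \<mu>] assms(1) show ?thesis using LIMSEQ_unique by blast
qed

text \<open>Two probability measures that agree on a multiplicative system of bounded functions agree on the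
  \<open>\<sigma>\<close>-algebra generated by it: finite intersections of the sets \<open>{f > a}\<close> form a \<open>\<pi>\<close>-system, on which
  equality follows by inserting indicators one at a time.\<close>

theorem multiplicative_system_eqI:
  fixes \<mu> \<nu> :: "'x measure" and A :: "('x \<Rightarrow> real) set"
  assumes pr: "prob_space \<mu>" "prob_space \<nu>"
    and sets: "sets \<mu> = sigma_sets \<Omega> {{x\<in>\<Omega>. a < f x} | f a. f \<in> A}"
      "sets \<nu> = sigma_sets \<Omega> {{x\<in>\<Omega>. a < f x} | f a. f \<in> A}"
    and one: "(\<lambda>_. 1) \<in> A"
    and mult: "\<And>f g. f \<in> A \<Longrightarrow> g \<in> A \<Longrightarrow> (\<lambda>x. f x * g x) \<in> A"
    and bdd: "\<And>f. f \<in> A \<Longrightarrow> \<exists>B. \<forall>x\<in>\<Omega>. \<bar>f x\<bar> \<le> B"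
    and eq: "\<And>f. f \<in> A \<Longrightarrow> (\<integral>x. f x \<partial>\<mu>) = (\<integral>x. f x \<partial>\<nu>)"
  shows "\<mu> = \<nu>"
proof -
  interpret \<mu>: prob_space \<mu> by fact
  interpret \<nu>: prob_space \<nu> by fact
  have Pow: "{{x\<in>\<Omega>. a < f x} | f a. f \<in> A} \<subseteq> Pow \<Omega>" by auto
  have sp: "space \<kappa> = \<Omega>" if "sets \<kappa> = sigma_sets \<Omega> {{x\<in>\<Omega>. a < f x} | f a. f \<in> A}" for \<kappa> :: "'x measure"
  proof
    show "space \<kappa> \<subseteq> \<Omega>"
      using sets.top[of \<kappa>] unfolding that by (rule sigma_sets_into_sp[OF Pow])
    show "\<Omega> \<subseteq> space \<kappa>"
      by (rule sets.sets_into_space) (simp add: that sigma_sets_top)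
  qed
  note sp = sp[OF sets(1)] sp[OF sets(2)]
  have meas: "f \<in> borel_measurable \<mu>" if "f \<in> A" for f
    unfolding borel_measurable_iff_greater sp sets using that by blast
  define ind where "ind S x = (\<Prod>p\<in>S. indicator {y. snd p < fst p y} x :: real)"
    for S :: "(('x \<Rightarrow> real) \<times> real) set" and x :: 'x
  have ind01: "0 \<le> ind S x" "ind S x \<le> (1 :: real)" for S x
    unfolding ind_def by (auto intro!: prod_nonneg prod_le_1)
  have ind_meas: "(ind S :: _ \<Rightarrow> real) \<in> borel_measurable \<mu>" if "fst ` S \<subseteq> A" for S
    unfolding ind_def
  proof (rule borel_measurable_prod)
    fix p assume "p \<in> S"
    then have [measurable]: "fst p \<in> borel_measurable \<mu>" using that by (intro meas) auto
    show "(indicator {y. snd p < fst p y} :: _ \<Rightarrow> real) \<in> borel_measurable \<mu>"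
      by (subst borel_measurable_indicator_iff) measurable
  qed
  have int_eq: "(\<integral>x. ind S x * g x \<partial>\<mu>) = (\<integral>x. ind S x * g x \<partial>\<nu>)"
    if "finite S" "fst ` S \<subseteq> A" "g \<in> A" for S and g :: "'x \<Rightarrow> real"
    using that
  proof (induction S arbitrary: g rule: finite_induct)
    case empty
    then show ?case by (simp add: ind_def eq)
  next
    case (insert p S)
    have i: "ind (insert p S) x = ind S x * indicator {y. snd p < fst p y} x" for x
      using insert.hyps by (simp add: ind_def mult.commute)
    show ?case unfolding i
      by (rule multiplicative_system_step[where A=A])
        (use insert ind01 ind_meas meas mult bdd pr sets sp in auto)
  qed
  define E where "E = {{x\<in>\<Omega>. \<forall>p\<in>S. snd p < fst p x} | S. finite S \<and> fst ` S \<subseteq> A}"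
  have E_ind: "measure \<mu> {x\<in>\<Omega>. \<forall>p\<in>S. snd p < fst p x} = (\<integral>x. ind S x * 1 \<partial>\<mu>)"
     "measure \<nu> {x\<in>\<Omega>. \<forall>p\<in>S. snd p < fst p x} = (\<integral>x. ind S x * 1 \<partial>\<nu>)"
     if S: "finite S" "fst ` S \<subseteq> A" for S
  proof -
    have *: "ind S x * 1 = indicator {x\<in>\<Omega>. \<forall>p\<in>S. snd p < fst p x} x" if "x \<in> \<Omega>" for x
      using S(1) that by (auto simp: ind_def indicator_def prod_zero_iff)
    show "measure \<mu> {x\<in>\<Omega>. \<forall>p\<in>S. snd p < fst p x} = (\<integral>x. ind S x * 1 \<partial>\<mu>)"
      "measure \<nu> {x\<in>\<Omega>. \<forall>p\<in>S. snd p < fst p x} = (\<integral>x. ind S x * 1 \<partial>\<nu>)"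
      by (subst Bochner_Integration.integral_cong[OF refl *]; simp add: sp Int_absorb2)+
  qed
  have gen: "sigma_sets \<Omega> E = sigma_sets \<Omega> {{x\<in>\<Omega>. a < f x} | f a. f \<in> A}"
  proof (rule sigma_sets_eqI)
    fix U assume "U \<in> E"
    then obtain S where S: "U = {x\<in>\<Omega>. \<forall>p\<in>S. snd p < fst p x}" "finite S" "fst ` S \<subseteq> A"
      by (auto simp: E_def)
    have "{x \<in> space \<mu>. \<forall>p\<in>S. snd p < fst p x} \<in> sets \<mu>"
    proof (rule sets.sets_Collect_finite_All[OF _ S(2)])
      fix p assume "p \<in> S"
      then show "{x \<in> space \<mu>. snd p < fst p x} \<in> sets \<mu>"
        using S(3) meas[of "fst p"] by (auto simp: borel_measurable_iff_greater)
    qed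
    then show "U \<in> sigma_sets \<Omega> {{x\<in>\<Omega>. a < f x} | f a. f \<in> A}" by (simp add: S sets sp)
  next
    fix U assume "U \<in> {{x\<in>\<Omega>. a < f x} | f a. f \<in> A}"
    then obtain f a where "U = {x\<in>\<Omega>. a < f x}" "f \<in> A" by blast
    then have "U \<in> E" unfolding E_def by (intro CollectI exI[of _ "{(f, a)}"]) auto
    then show "U \<in> sigma_sets \<Omega> E" by blast
  qed
  show ?thesis
  proof (rule measure_eqI_generator_eq[where E=E and \<Omega>=\<Omega> and A="\<lambda>_. \<Omega>"])
    show "Int_stable E"
    proof (rule Int_stableI)
      fix U V assume "U \<in> E" "V \<in> E"
      then obtain S T where "U = {x\<in>\<Omega>. \<forall>p\<in>S. snd p < fst p x}" "finite S" "fst ` S \<subseteq> A"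
          "V = {x\<in>\<Omega>. \<forall>p\<in>T. snd p < fst p x}" "finite T" "fst ` T \<subseteq> A"
        unfolding E_def by blast
      then show "U \<inter> V \<in> E" unfolding E_def by (intro CollectI exI[of _ "S \<union> T"]) auto
    qed
    show "E \<subseteq> Pow \<Omega>" by (auto simp: E_def)
    show "range (\<lambda>_ :: nat. \<Omega>) \<subseteq> E"
      unfolding E_def by (intro image_subsetI CollectI exI[of _ "{}"]) auto
    fix U assume "U \<in> E"
    then obtain S where S: "U = {x\<in>\<Omega>. \<forall>p\<in>S. snd p < fst p x}" "finite S" "fst ` S \<subseteq> A"
      by (auto simp: E_def)
    then show "emeasure \<mu> U = emeasure \<nu> U"
      using int_eq[OF S(2,3) one] E_ind[OF S(2,3)]
      by (simp add: \<mu>.emeasure_eq_measure \<nu>.emeasure_eq_measure)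
  qed (simp_all only: gen sets, simp_all)
qed

section \<open>Bounded test functions on the group\<close>

text \<open>The pairings are required only on the group, because multiplicativity holds only there. Boundedness
  is demanded separately: a pairing with exponentially bounded coefficients is in general unbounded,
  while matrix entries of orthogonal representations are bounded.\<close>

definition test_functions :: "(nat \<Rightarrow> 'd rtree) \<Rightarrow> ('d series \<Rightarrow> real) set" where
  "test_functions \<tau> = {f. (\<exists>k a. exp_bounded a \<and> (\<forall>h\<in>G \<tau>. f h = pairing k a (expansion \<tau> h))) \<and>
     (\<exists>B. \<forall>h\<in>G \<tau>. \<bar>f h\<bar> \<le> B)}"

context
  fixes \<tau> :: "nat \<Rightarrow> 'd::finite rtree"
  assumes free: "free_generators \<tau>"
begin

lemma G_expansion:
  assumes "h \<in> G \<tau>"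
  shows "shuffle_character (expansion \<tau> h)" "entire (expansion \<tau> h)"
  using assms shuffle_character_expansion[OF free] by (auto simp: G_def Hhat_iff_entire)

lemma one_test_function: "(\<lambda>_. 1) \<in> test_functions \<tau>"
proof -
  let ?a = "\<lambda>w :: nat list. of_bool (w = []) :: real"
  have deg: "pair_deg 0 ?a c = (\<lambda>m. if m = 0 then c [] else 0)" for c
    by (auto simp: pair_deg_def words_def fun_eq_iff intro!: sum.neutral)
  have "pairing 0 ?a c = c []" for c
    unfolding pairing_def deg using sums_single[of 0 "\<lambda>_. c []"] by (simp add: sums_iff)
  moreover have "exp_bounded ?a"
    unfolding exp_bounded_def by (intro exI[of _ 1] conjI) auto
  ultimately show ?thesis
    using G_expansion(1) unfolding test_functions_def shuffle_character_def
    by (auto intro!: exI[of _ "0 :: nat"] exI[of _ ?a])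
qed

lemma mult_test_function:
  assumes "f \<in> test_functions \<tau>" "g \<in> test_functions \<tau>"
  shows "(\<lambda>h. f h * g h) \<in> test_functions \<tau>"
proof -
  from assms obtain k a B k' b C where
    f: "exp_bounded a" "\<And>h. h \<in> G \<tau> \<Longrightarrow> f h = pairing k a (expansion \<tau> h)" "\<And>h. h \<in> G \<tau> \<Longrightarrow> \<bar>f h\<bar> \<le> B" and
    g: "exp_bounded b" "\<And>h. h \<in> G \<tau> \<Longrightarrow> g h = pairing k' b (expansion \<tau> h)" "\<And>h. h \<in> G \<tau> \<Longrightarrow> \<bar>g h\<bar> \<le> C"
    unfolding test_functions_def by blast
  define K where "K = max k k'"
  define d where "d = unshuffle_prod (restrict_letters k a) (restrict_letters k' b)"
  have "f h * g h = pairing K d (expansion \<tau> h)" if h: "h \<in> G \<tau>" for h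
  proof -
    have "f h * g h = pairing K (restrict_letters k a) (expansion \<tau> h) * pairing K (restrict_letters k' b) (expansion \<tau> h)"
      by (simp add: f(2)[OF h] g(2)[OF h] pairing_restrict K_def)
    also have "\<dots> = pairing K d (expansion \<tau> h)"
      unfolding d_def by (intro pairing_mult G_expansion exp_bounded_restrict f g h)
    finally show ?thesis .
  qed
  moreover have "exp_bounded d"
    unfolding d_def by (intro exp_bounded_unshuffle_prod exp_bounded_restrict f g)
  moreover have "\<bar>f h * g h\<bar> \<le> B * C" if "h \<in> G \<tau>" for h
    unfolding abs_mult using f(3)[OF that] g(3)[OF that] by (intro mult_mono) auto
  ultimately show ?thesis by (auto simp: test_functions_def)
qed

lemma walk_test_function:
  "(\<lambda>h. pairing k (dilate t (\<lambda>u. walk w u 0)) (expansion \<tau> h)) \<in> test_functions \<tau>"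
proof -
  have "\<bar>pairing k (dilate t (\<lambda>u. walk w u 0)) (expansion \<tau> h)\<bar> \<le> 1" if "h \<in> G \<tau>" for h
    unfolding pairing_dilate using G_expansion[OF that]
    by (intro abs_pairing_walk_le shuffle_character_dilate entire_dilate) auto
  then show ?thesis
    using exp_bounded_dilate[OF exp_bounded_walk] unfolding test_functions_def by blast
qed

lemma measurable_test_function:
  assumes "f \<in> test_functions \<tau>"
  shows "f \<in> borel_measurable (G_borel \<tau>)"
proof -
  from assms obtain k a where f: "\<And>h. h \<in> G \<tau> \<Longrightarrow> f h = pairing k a (expansion \<tau> h)"
    by (auto simp: test_functions_def)
  note [measurable] = measurable_expansion[OF free]
  have "(\<lambda>h. pairing k a (expansion \<tau> h)) \<in> borel_measurable (G_borel \<tau>)"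
    unfolding pairing_def pair_deg_def by measurable
  then show ?thesis by (subst measurable_cong[where g="\<lambda>h. pairing k a (expansion \<tau> h)"]) (auto simp: f)
qed

text \<open>Coordinates are limits of rescaled test functions, and the coordinates generate all open sets.\<close>

lemma sets_G_borel_test_functions:
  "sets (G_borel \<tau>) = sigma_sets (G \<tau>) {{h\<in>G \<tau>. a < f h} | f a. f \<in> test_functions \<tau>}"
proof
  let ?E = "{{h\<in>G \<tau>. a < f h} | f a. f \<in> test_functions \<tau>}"
  define S where "S = sigma (G \<tau>) ?E"
  have E: "?E \<subseteq> Pow (G \<tau>)" by auto
  have sp: "space S = G \<tau>" and st: "sets S = sigma_sets (G \<tau>) ?E"
    using E by (simp_all add: S_def space_measure_of sets_measure_of)
  have meas: "f \<in> borel_measurable S" if "f \<in> test_functions \<tau>" for f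
    unfolding borel_measurable_iff_greater sp st using that by blast
  have "(\<lambda>h. expansion \<tau> h w) \<in> borel_measurable S" for w
  proof -
    obtain k where k: "set w \<subseteq> {..<k}"
      using finite_nat_iff_bounded[of "set w"] by auto
    define f where "f n h = pairing k (dilate (1 / real (Suc n)) (\<lambda>u. walk w u 0)) (expansion \<tau> h) * real (Suc n) ^ length w"
      for n h
    have "(\<lambda>h. f n h) \<in> borel_measurable S" for n
      unfolding f_def using meas[OF walk_test_function] by measurable
    moreover have "(\<lambda>n. f n h) \<longlonglongrightarrow> expansion \<tau> h w" if "h \<in> space S" for h
    proof -
      have scale: "filterlim (\<lambda>n. 1 / real (Suc n)) (at 0) sequentially"
        unfolding filterlim_at using LIMSEQ_inverse_real_of_nat by (auto simp: inverse_eq_divide)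
      have "h \<in> G \<tau>" using that sp by simp
      from filterlim_compose[OF walk_pairing_recovers[OF G_expansion(2)[OF this] k] scale]
      have "(\<lambda>n. pairing k (\<lambda>u. walk w u 0) (dilate (1 / real (Suc n)) (expansion \<tau> h)) / (1 / real (Suc n)) ^ length w)
        \<longlonglongrightarrow> expansion \<tau> h w" .
      then show ?thesis by (simp add: f_def pairing_dilate power_divide)
    qed
    ultimately show ?thesis by (rule borel_measurable_LIMSEQ_real[rotated])
  qed
  then have "{U. openin (G_topology \<tau>) U} \<subseteq> sets S"
    using open_in_coordinate_sigma_algebra[OF free sp] by blast
  then show "sets (G_borel \<tau>) \<subseteq> sigma_sets (G \<tau>) ?E"
    using sets.sigma_sets_subset[of _ S] unfolding sets_G_borel sp st by blast
  have "{h\<in>space (G_borel \<tau>). a < f h} \<in> sets (G_borel \<tau>)" if "f \<in> test_functions \<tau>" for f a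
    using measurable_test_function[OF that] by (simp add: borel_measurable_iff_greater)
  then show "sigma_sets (G \<tau>) ?E \<subseteq> sets (G_borel \<tau>)"
    using sets.sigma_sets_subset[of ?E "G_borel \<tau>"] by auto
qed

text \<open>A coordinate is a finite linear combination of forest coefficients, so it commutes with the
  expectation.\<close>

lemma expansion_ESig:
  assumes "X \<in> measurable M (G_borel \<tau>)" "ESig_exists M X"
  shows "integrable (distr M (G_borel \<tau>) X) (\<lambda>h. expansion \<tau> h w)"
    and "(\<integral>h. expansion \<tau> h w \<partial>distr M (G_borel \<tau>) X) = expansion \<tau> (ESig M X) w"
  using assms
  by (simp_all add: integrable_distr_eq integral_distr measurable_expansion[OF free])
    (simp_all add: expansion_eq[OF free] ESig_exists_def ESig_def)

lemma integral_test_function: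
  assumes "prob_space M" and X: "X \<in> measurable M (G_borel \<tau>)" "ESig_exists M X" "ESig M X \<in> Hhat \<tau>"
    and a: "exp_bounded a" "\<And>h. h \<in> G \<tau> \<Longrightarrow> f h = pairing k a (expansion \<tau> h)"
  shows "(\<integral>h. f h \<partial>distr M (G_borel \<tau>) X) = pairing k a (expansion \<tau> (ESig M X))"
proof -
  interpret prob_space M by fact
  let ?\<mu> = "distr M (G_borel \<tau>) X"
  have "(\<integral>h. f h \<partial>?\<mu>) = (\<integral>h. pairing k a (expansion \<tau> h) \<partial>?\<mu>)"
    by (intro Bochner_Integration.integral_cong) (auto simp: a)
  also have "\<dots> = pairing k a (\<lambda>w. \<integral>h. expansion \<tau> h w \<partial>?\<mu>)"
    using X(3) by (intro expected_pairing prob_space_distr X a expansion_ESig G_expansion)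
      (auto simp: expansion_ESig[OF X(1,2)] Hhat_iff_entire)
  finally show ?thesis by (simp add: expansion_ESig[OF X(1,2)])
qed

end

theorem proposition5p16:
  fixes \<tau> :: "nat \<Rightarrow> ('d::finite) rtree"
    and M :: "'a measure" and N :: "'b measure"
    and X :: "'a \<Rightarrow> 'd series" and Y :: "'b \<Rightarrow> 'd series"
  assumes "free_generators \<tau>"
    and "prob_space M" and "prob_space N"
    and "X \<in> measurable M (G_borel \<tau>)" and "Y \<in> measurable N (G_borel \<tau>)"
    and "ESig_exists M X" and "ESig M X \<in> Hhat \<tau>"
    and "ESig_exists N Y"
    and "ESig M X = ESig N Y"
  shows "distr M (G_borel \<tau>) X = distr N (G_borel \<tau>) Y"
proof (rule multiplicative_system_eqI[where A="test_functions \<tau>" and \<Omega>="G \<tau>"])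
  note free = assms(1)
  show "prob_space (distr M (G_borel \<tau>) X)" "prob_space (distr N (G_borel \<tau>) Y)"
    using assms by (auto intro!: prob_space.prob_space_distr)
  show "sets (distr M (G_borel \<tau>) X) = sigma_sets (G \<tau>) {{h\<in>G \<tau>. a < f h} | f a. f \<in> test_functions \<tau>}"
    "sets (distr N (G_borel \<tau>) Y) = sigma_sets (G \<tau>) {{h\<in>G \<tau>. a < f h} | f a. f \<in> test_functions \<tau>}"
    by (simp_all add: sets_G_borel_test_functions[OF free])
  show "(\<lambda>_. 1) \<in> test_functions \<tau>" by (rule one_test_function[OF free])
  show "(\<lambda>h. f h * g h) \<in> test_functions \<tau>" if "f \<in> test_functions \<tau>" "g \<in> test_functions \<tau>" for f g
    using mult_test_function[OF free that] .
  fix f assume f: "f \<in> test_functions \<tau>"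
  then show "\<exists>B. \<forall>h\<in>G \<tau>. \<bar>f h\<bar> \<le> B" by (simp add: test_functions_def)
  from f obtain k a where ka: "exp_bounded a" "\<And>h. h \<in> G \<tau> \<Longrightarrow> f h = pairing k a (expansion \<tau> h)"
    by (auto simp: test_functions_def)
  have "(\<integral>h. f h \<partial>distr M (G_borel \<tau>) X) = pairing k a (expansion \<tau> (ESig M X))"
    by (rule integral_test_function[OF free]) (use assms ka in auto)
  moreover have "(\<integral>h. f h \<partial>distr N (G_borel \<tau>) Y) = pairing k a (expansion \<tau> (ESig N Y))"
    by (rule integral_test_function[OF free]) (use assms ka in auto)
  ultimately show "(\<integral>h. f h \<partial>distr M (G_borel \<tau>) X) = (\<integral>h. f h \<partial>distr N (G_borel \<tau>) Y)"
    using assms by simp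
qed

end
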